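(* Let $\Omega\subseteq\mathbb{C}$ be an open set such that $(\mathbb{C}\cup\{\infty\})\setminus\overline{\Omega}$ is connected, and let $\mathcal{F}\subseteq\mathbb{N}\times\mathbb{N}$ contain a sequence $(\tilde p_n,\tilde q_n)$, $n=1,2,\dots$, with $\tilde p_n\to+\infty$. Generically every function $f\in X^\infty$ has the following property: there exists a sequence $(p_n,q_n)_{n\in\mathbb{N}}$ in $\mathcal{F}$ such that for every compact set $K\subseteq\overline{\Omega}$ there is an $n(K)\in\mathbb{N}$ so that for every $n\ge n(K)$ it holds that $f\in\mathcal{D}_{p_n,q_n}(\zeta)$ for all $\zeta\in K$, and $\sup_{\zeta\in K}\sup_{z\in K}\big|[p_n/q_n]^{(\ell)}_{f,\zeta}(z)-f^{(\ell)}(z)\big|\to 0$ as $n\to+\infty$, for every $\ell=0,1,2,\dots$.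
   Context: "Generically every $f\in X^\infty$ has a property" means that the property holds for all $f$ in some $G_\delta$ and dense subset of $X^\infty$. $\overline{\Omega}$ is the closure of $\Omega$ in $\mathbb{C}$. $A^\infty(\Omega)$ is the set of $f$ holomorphic in $\Omega$ such that every derivative $f^{(\ell)}$, $\ell=0,1,2,\dots$, extends continuously to $\overline{\Omega}$ (the extension is still denoted $f^{(\ell)}$); it is a Fréchet space with the topology in which $f_m\to f$ iff $f_m^{(\ell)}\to f^{(\ell)}$ uniformly on each compact subset of $\overline{\Omega}$ for every $\ell$. $H(\overline{\Omega})$ is the set of functions holomorphic on some (varying) open set containing $\overline{\Omega}$, and $X^\infty$ is the closure of $H(\overline{\Omega})$ in $A^\infty(\Omega)$, with the induced topology. Padé approximants. Degrees $p,q$ range over $\mathbb{N}=\{0,1,2,\dots\}$. For $f\in A^\infty(\Omega)$ and $\zeta\in\overline{\Omega}$ put $a_v=f^{(v)}(\zeta)/v!$ (for $\zeta\in\partial\Omega$ defined by continuous extension), and consider the formal series $\sum_{v\ge0}a_v(z-\zeta)^v$. A Padé approximant $[p/q]_{f,\zeta}$ is a rational function of the form $P/Q$, $P(z)=\sum_{v=0}^p n_v(z-\zeta)^v$, $Q(z)=\sum_{v=0}^q d_v(z-\zeta)^v$ with $d_0=1$, whose Taylor coefficients $b_v$ at $\zeta$ satisfy $b_v=a_v$ for $v=0,\dots,p+q$. We write $f\in\mathcal{D}_{p,q}(\zeta)$ if the Hankel determinant $\det\big(a_{p-q+i+j-1}\big)_{i,j=1}^q$ is nonzero, with $a_i=0$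 for $i<0$ (for $q=0$ the condition is always satisfied). In that case $[p/q]_{f,\zeta}$ exists and is unique. $[p/q]^{(\ell)}_{f,\zeta}$ denotes its $\ell$-th derivative in $z$. The value of a rational function at a pole is taken to be $\infty$, so a finite supremum over $K$ means that there are no poles in $K$. *)

theory Defs
  imports
    "HOL-Complex_Analysis.Complex_Analysis"
    Jordan_Normal_Form.Determinant
begin

definition riemann_sphere :: "complex option topology" where
  "riemann_sphere = Alexandroff_compactification euclidean"

(* Only used for z in closure \<Omega>; there it is the value at z of the continuous
   extension of the l-th derivative, cf. closure_deriv_eq. *)
definition closure_deriv :: "complex set \<Rightarrow> nat \<Rightarrow> (complex \<Rightarrow> complex) \<Rightarrow> complex \<Rightarrow> complex" where
  "closure_deriv \<Omega> l f z = Lim (at z within \<Omega>) ((deriv ^^ l) f)"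

(* Functions on \<Omega> are represented by elements of extensional \<Omega>, so that equality
   of functions on \<Omega> is equality in HOL. *)
definition A_inf :: "complex set \<Rightarrow> (complex \<Rightarrow> complex) set" where
  "A_inf \<Omega> = {f \<in> extensional \<Omega>. f holomorphic_on \<Omega> \<and>
     (\<forall>l. \<exists>g. continuous_on (closure \<Omega>) g \<and> (\<forall>z\<in>\<Omega>. g z = (deriv ^^ l) f z))}"

definition A_inf_nbhd ::
  "complex set \<Rightarrow> (complex \<Rightarrow> complex) \<Rightarrow> complex set \<Rightarrow> nat \<Rightarrow> real \<Rightarrow> (complex \<Rightarrow> complex) set" where
  "A_inf_nbhd \<Omega> f K N \<epsilon> = {g \<in> A_inf \<Omega>. \<forall>l\<le>N. \<forall>z\<in>K.
     cmod (closure_deriv \<Omega> l g z - closure_deriv \<Omega> l f z) < \<epsilon>}"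

definition A_inf_topology :: "complex set \<Rightarrow> (complex \<Rightarrow> complex) topology" where
  "A_inf_topology \<Omega> = topology (\<lambda>U. U \<subseteq> A_inf \<Omega> \<and>
     (\<forall>f\<in>U. \<exists>K N \<epsilon>. compact K \<and> K \<subseteq> closure \<Omega> \<and> \<epsilon> > 0 \<and> A_inf_nbhd \<Omega> f K N \<epsilon> \<subseteq> U))"

definition H_closure :: "complex set \<Rightarrow> (complex \<Rightarrow> complex) set" where
  "H_closure \<Omega> = {restrict h \<Omega> | h V. open V \<and> closure \<Omega> \<subseteq> V \<and> h holomorphic_on V}"

definition X_inf :: "complex set \<Rightarrow> (complex \<Rightarrow> complex) topology" where
  "X_inf \<Omega> = subtopology (A_inf_topology \<Omega>) (A_inf_topology \<Omega> closure_of H_closure \<Omega>)"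

definition generically :: "'a topology \<Rightarrow> ('a \<Rightarrow> bool) \<Rightarrow> bool" where
  "generically X P \<longleftrightarrow>
     (\<exists>G. gdelta_in X G \<and> X closure_of G = topspace X \<and> (\<forall>f\<in>G. P f))"

definition taylor_coeff :: "complex set \<Rightarrow> (complex \<Rightarrow> complex) \<Rightarrow> complex \<Rightarrow> int \<Rightarrow> complex" where
  "taylor_coeff \<Omega> f \<zeta> i =
     (if i < 0 then 0 else closure_deriv \<Omega> (nat i) f \<zeta> / fact (nat i))"

(* Matrix indices start at 0 here, hence the shift by 2 in the Hankel entries. *)
definition pade_class :: "complex set \<Rightarrow> nat \<Rightarrow> nat \<Rightarrow> complex \<Rightarrow> (complex \<Rightarrow> complex) set" where
  "pade_class \<Omega> p q \<zeta> = {f \<in> A_inf \<Omega>.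
     Determinant.det (Matrix.mat q q
       (\<lambda>(i, j). taylor_coeff \<Omega> f \<zeta> (int p - int q + int i + int j + 1))) \<noteq> 0}"

(* remove_sings fills in the removable singularities at common zeros of P and Q and
   takes the value 0 at poles, so that one rational function is one HOL function.
   P and Q are polynomials in z - \<zeta>. *)
definition is_pade ::
  "complex set \<Rightarrow> (complex \<Rightarrow> complex) \<Rightarrow> nat \<Rightarrow> nat \<Rightarrow> complex \<Rightarrow> (complex \<Rightarrow> complex) \<Rightarrow> bool" where
  "is_pade \<Omega> f p q \<zeta> R \<longleftrightarrow>
     (\<exists>P Q. degree P \<le> p \<and> degree Q \<le> q \<and> poly.coeff Q 0 = 1 \<and>
        R = remove_sings (\<lambda>z. poly P (z - \<zeta>) / poly Q (z - \<zeta>))) \<and>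
     (\<forall>v\<le>p + q. fps_nth (fps_expansion R \<zeta>) v = taylor_coeff \<Omega> f \<zeta> (int v))"

definition pade ::
  "complex set \<Rightarrow> (complex \<Rightarrow> complex) \<Rightarrow> nat \<Rightarrow> nat \<Rightarrow> complex \<Rightarrow> complex \<Rightarrow> complex" where
  "pade \<Omega> f p q \<zeta> = (THE R. is_pade \<Omega> f p q \<zeta> R)"

(* The modulus of r z - w for a rational function r, whose value at a pole is \<infinity>. *)
definition rational_dist :: "(complex \<Rightarrow> complex) \<Rightarrow> complex \<Rightarrow> complex \<Rightarrow> ennreal" where
  "rational_dist r z w = (if is_pole r z then \<infinity> else ennreal (cmod (r z - w)))"


lemma closure_deriv_eq:
  assumes "open \<Omega>" "continuous_on (closure \<Omega>) g" "\<And>z. z \<in> \<Omega> \<Longrightarrow> g z = (deriv ^^ l) f z"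
    and "z \<in> closure \<Omega>"
  shows "closure_deriv \<Omega> l f z = g z"
proof -
  have nt: "at z within \<Omega> \<noteq> bot"
  proof (cases "z \<in> \<Omega>")
    case True
    show ?thesis unfolding at_within_open[OF True \<open>open \<Omega>\<close>] by (rule at_neq_bot)
  next
    case False
    then have "z islimpt \<Omega>" using assms(4) unfolding closure_def by blast
    then show ?thesis unfolding trivial_limit_within by blast
  qed
  have "(g \<longlongrightarrow> g z) (at z within closure \<Omega>)"
    using assms(2,4) by (simp add: continuous_on_def)
  then have "(g \<longlongrightarrow> g z) (at z within \<Omega>)"
    by (rule tendsto_within_subset) (rule closure_subset)
  moreover have "eventually (\<lambda>w. g w = (deriv ^^ l) f w) (at z within \<Omega>)"
    unfolding eventually_at_filter using assms(3) by (intro always_eventually allI impI)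
  ultimately have "((deriv ^^ l) f \<longlongrightarrow> g z) (at z within \<Omega>)"
    by (rule Lim_transform_eventually)
  then show ?thesis unfolding closure_deriv_def by (rule tendsto_Lim[OF nt])
qed

lemma A_inf_nbhd_mono:
  assumes "K' \<subseteq> K" "N' \<le> N" "\<epsilon> \<le> \<epsilon>'"
  shows "A_inf_nbhd \<Omega> f K N \<epsilon> \<subseteq> A_inf_nbhd \<Omega> f K' N' \<epsilon>'"
proof
  fix g assume g: "g \<in> A_inf_nbhd \<Omega> f K N \<epsilon>"
  have "cmod (closure_deriv \<Omega> l g z - closure_deriv \<Omega> l f z) < \<epsilon>'" if "l \<le> N'" "z \<in> K'" for l z
  proof -
    have "l \<le> N" "z \<in> K" using that assms by auto
    then have "cmod (closure_deriv \<Omega> l g z - closure_deriv \<Omega> l f z) < \<epsilon>"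
      using g unfolding A_inf_nbhd_def by blast
    then show ?thesis using assms(3) by linarith
  qed
  then show "g \<in> A_inf_nbhd \<Omega> f K' N' \<epsilon>'" using g unfolding A_inf_nbhd_def by blast
qed

lemma istopology_A_inf:
  "istopology (\<lambda>U. U \<subseteq> A_inf \<Omega> \<and>
     (\<forall>f\<in>U. \<exists>K N \<epsilon>. compact K \<and> K \<subseteq> closure \<Omega> \<and> \<epsilon> > 0 \<and> A_inf_nbhd \<Omega> f K N \<epsilon> \<subseteq> U))"
  (is "istopology ?T")
  unfolding istopology_def
proof (intro conjI allI impI)
  fix S T assume S: "?T S" and T: "?T T"
  have "\<exists>K N \<epsilon>. compact K \<and> K \<subseteq> closure \<Omega> \<and> \<epsilon> > 0 \<and> A_inf_nbhd \<Omega> f K N \<epsilon> \<subseteq> S \<inter> T"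
    if f: "f \<in> S \<inter> T" for f
  proof -
    obtain K N \<epsilon> K' N' \<epsilon>' where "compact K" "K \<subseteq> closure \<Omega>" "\<epsilon> > (0::real)" "A_inf_nbhd \<Omega> f K N \<epsilon> \<subseteq> S"
      "compact K'" "K' \<subseteq> closure \<Omega>" "\<epsilon>' > (0::real)" "A_inf_nbhd \<Omega> f K' N' \<epsilon>' \<subseteq> T"
      using S[THEN conjunct2, rule_format, OF IntD1[OF f]]
        T[THEN conjunct2, rule_format, OF IntD2[OF f]] by blast
    moreover have "A_inf_nbhd \<Omega> f (K \<union> K') (max N N') (min \<epsilon> \<epsilon>') \<subseteq> A_inf_nbhd \<Omega> f K N \<epsilon>"
      "A_inf_nbhd \<Omega> f (K \<union> K') (max N N') (min \<epsilon> \<epsilon>') \<subseteq> A_inf_nbhd \<Omega> f K' N' \<epsilon>'"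
      by (intro A_inf_nbhd_mono; auto)+
    ultimately show ?thesis
      by (intro exI[of _ "K \<union> K'"] exI[of _ "max N N'"] exI[of _ "min \<epsilon> \<epsilon>'"]) auto
  qed
  then show "\<forall>f\<in>S \<inter> T.
      \<exists>K N \<epsilon>. compact K \<and> K \<subseteq> closure \<Omega> \<and> \<epsilon> > 0 \<and> A_inf_nbhd \<Omega> f K N \<epsilon> \<subseteq> S \<inter> T"
    by blast
  show "S \<inter> T \<subseteq> A_inf \<Omega>" using S by blast
next
  fix \<K> assume K: "\<forall>U\<in>\<K>. ?T U"
  then show "\<Union>\<K> \<subseteq> A_inf \<Omega>" by blast
  show "\<forall>f\<in>\<Union>\<K>. \<exists>K N \<epsilon>. compact K \<and> K \<subseteq> closure \<Omega> \<and> \<epsilon> > 0 \<and> A_inf_nbhd \<Omega> f K N \<epsilon> \<subseteq> \<Union>\<K>"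
  proof
    fix f assume "f \<in> \<Union>\<K>"
    then obtain U where U: "U \<in> \<K>" "f \<in> U" by blast
    obtain L N \<epsilon> where L:
      "compact L" "L \<subseteq> closure \<Omega>" "\<epsilon> > (0::real)" "A_inf_nbhd \<Omega> f L N \<epsilon> \<subseteq> U"
      using bspec[OF conjunct2[OF bspec[OF K U(1)]] U(2)] by (elim exE conjE)
    moreover have "A_inf_nbhd \<Omega> f L N \<epsilon> \<subseteq> \<Union>\<K>" using L(4) U(1) by blast
    ultimately show "\<exists>K N \<epsilon>. compact K \<and> K \<subseteq> closure \<Omega> \<and> \<epsilon> > 0 \<and>
        A_inf_nbhd \<Omega> f K N \<epsilon> \<subseteq> \<Union>\<K>"
      by (intro exI conjI)
  qed
qed

lemma openin_A_inf_topology: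
  "openin (A_inf_topology \<Omega>) U \<longleftrightarrow> U \<subseteq> A_inf \<Omega> \<and>
     (\<forall>f\<in>U. \<exists>K N \<epsilon>. compact K \<and> K \<subseteq> closure \<Omega> \<and> \<epsilon> > 0 \<and> A_inf_nbhd \<Omega> f K N \<epsilon> \<subseteq> U)"
  unfolding A_inf_topology_def topology_inverse'[OF istopology_A_inf] by (rule refl)

lemma topspace_A_inf_topology [simp]: "topspace (A_inf_topology \<Omega>) = A_inf \<Omega>"
proof -
  have "openin (A_inf_topology \<Omega>) (A_inf \<Omega>)"
    unfolding openin_A_inf_topology
  proof (intro conjI ballI subset_refl)
    fix f
    have "compact {} \<and> {} \<subseteq> closure \<Omega> \<and> (1::real) > 0 \<and> A_inf_nbhd \<Omega> f {} 0 1 \<subseteq> A_inf \<Omega>"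
      by (auto simp: A_inf_nbhd_def)
    then show "\<exists>K N \<epsilon>. compact K \<and> K \<subseteq> closure \<Omega> \<and> \<epsilon> > 0 \<and> A_inf_nbhd \<Omega> f K N \<epsilon> \<subseteq> A_inf \<Omega>"
      by (intro exI)
  qed
  moreover have "topspace (A_inf_topology \<Omega>) \<subseteq> A_inf \<Omega>"
    using openin_topspace[of "A_inf_topology \<Omega>"] unfolding openin_A_inf_topology by (rule conjunct1)
  ultimately show ?thesis by (intro subset_antisym openin_subset)
qed

lemma openin_A_inf_nbhd_interior:
  assumes "open \<Omega>" "compact K" "K \<subseteq> closure \<Omega>" "\<epsilon> > 0" "f \<in> A_inf \<Omega>"
  shows "\<exists>U. openin (A_inf_topology \<Omega>) U \<and> f \<in> U \<and> U \<subseteq> A_inf_nbhd \<Omega> f K N \<epsilon>"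
proof (intro exI conjI)
  define U where "U = (\<Union>\<delta>\<in>{0<..<\<epsilon>}. A_inf_nbhd \<Omega> f K N \<delta>)"
  have "\<exists>\<eta>>0. A_inf_nbhd \<Omega> g K N \<eta> \<subseteq> U" if g: "g \<in> U" for g
  proof -
    obtain \<delta> where d: "0 < \<delta>" "\<delta> < \<epsilon>" "g \<in> A_inf_nbhd \<Omega> f K N \<delta>"
      using g unfolding U_def by auto
    have "A_inf_nbhd \<Omega> g K N ((\<epsilon> - \<delta>)/2) \<subseteq> A_inf_nbhd \<Omega> f K N ((\<epsilon> + \<delta>)/2)"
    proof
      fix h assume h: "h \<in> A_inf_nbhd \<Omega> g K N ((\<epsilon> - \<delta>)/2)"
      have "cmod (closure_deriv \<Omega> l h z - closure_deriv \<Omega> l f z) < (\<epsilon> + \<delta>)/2"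
        if "l \<le> N" "z \<in> K" for l z
      proof -
        have "cmod (closure_deriv \<Omega> l h z - closure_deriv \<Omega> l g z) < (\<epsilon> - \<delta>)/2"
          "cmod (closure_deriv \<Omega> l g z - closure_deriv \<Omega> l f z) < \<delta>"
          using h d that by (auto simp: A_inf_nbhd_def)
        moreover have "cmod (closure_deriv \<Omega> l h z - closure_deriv \<Omega> l f z) \<le>
          cmod (closure_deriv \<Omega> l h z - closure_deriv \<Omega> l g z) +
          cmod (closure_deriv \<Omega> l g z - closure_deriv \<Omega> l f z)"
          by (rule order_trans[OF _ norm_triangle_ineq]) simp
        ultimately show ?thesis by (simp add: field_simps)
      qed
      then show "h \<in> A_inf_nbhd \<Omega> f K N ((\<epsilon> + \<delta>)/2)"
        using h by (auto simp: A_inf_nbhd_def)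
    qed
    also have "\<dots> \<subseteq> U" unfolding U_def using d by (intro UN_upper) auto
    finally show ?thesis using d by (intro exI[of _ "(\<epsilon> - \<delta>)/2"]) auto
  qed
  moreover have "U \<subseteq> A_inf \<Omega>" by (auto simp: U_def A_inf_nbhd_def)
  ultimately show "openin (A_inf_topology \<Omega>) U"
    unfolding openin_A_inf_topology using assms(2,3) by meson
  show "f \<in> U"
    unfolding U_def A_inf_nbhd_def using assms dense[of 0 \<epsilon>] by auto
  show "U \<subseteq> A_inf_nbhd \<Omega> f K N \<epsilon>"
    unfolding U_def by (intro UN_least A_inf_nbhd_mono) auto
qed

lemma limitin_A_inf_topology:
  assumes "open \<Omega>"
  shows "limitin (A_inf_topology \<Omega>) F f sequentially \<longleftrightarrow>
    f \<in> A_inf \<Omega> \<and> (\<forall>\<^sub>F m in sequentially. F m \<in> A_inf \<Omega>) \<and>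
    (\<forall>l K. compact K \<and> K \<subseteq> closure \<Omega> \<longrightarrow>
      uniform_limit K (\<lambda>m. closure_deriv \<Omega> l (F m)) (closure_deriv \<Omega> l f) sequentially)"
  (is "?L \<longleftrightarrow> ?R")
proof
  assume L: ?L
  then have f: "f \<in> A_inf \<Omega>" by (simp add: limitin_def)
  have ev: "\<forall>\<^sub>F m in sequentially. F m \<in> A_inf_nbhd \<Omega> f K N \<epsilon>"
    if K: "compact K" "K \<subseteq> closure \<Omega>" "\<epsilon> > 0" for K N \<epsilon>
  proof -
    obtain U where U: "openin (A_inf_topology \<Omega>) U" "f \<in> U" "U \<subseteq> A_inf_nbhd \<Omega> f K N \<epsilon>"
      using openin_A_inf_nbhd_interior[OF assms K f] by blast
    then have "\<forall>\<^sub>F m in sequentially. F m \<in> U" using L by (simp add: limitin_def)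
    then show ?thesis by eventually_elim (use U in blast)
  qed
  have "\<forall>\<^sub>F m in sequentially. F m \<in> A_inf \<Omega>"
    using ev[of "{}" 1 0] by (simp add: A_inf_nbhd_def)
  moreover have "uniform_limit K (\<lambda>m. closure_deriv \<Omega> l (F m)) (closure_deriv \<Omega> l f) sequentially"
    if "compact K" "K \<subseteq> closure \<Omega>" for l K
    unfolding uniform_limit_iff
  proof (intro allI impI)
    fix e :: real assume "e > 0"
    from ev[OF that this, of l]
    show "\<forall>\<^sub>F m in sequentially. \<forall>z\<in>K. dist (closure_deriv \<Omega> l (F m) z) (closure_deriv \<Omega> l f z) < e"
      by eventually_elim (auto simp: A_inf_nbhd_def dist_norm)
  qed
  ultimately show ?R using f by blast
next
  assume R: ?R
  show ?L
    unfolding limitin_def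
  proof (intro conjI allI impI)
    show "f \<in> topspace (A_inf_topology \<Omega>)" using R by simp
    fix U assume "openin (A_inf_topology \<Omega>) U \<and> f \<in> U"
    then obtain K N \<epsilon> where K: "compact K" "K \<subseteq> closure \<Omega>" "\<epsilon> > (0::real)"
      and U: "A_inf_nbhd \<Omega> f K N \<epsilon> \<subseteq> U"
      unfolding openin_A_inf_topology by blast
    have "\<forall>\<^sub>F m in sequentially. \<forall>l\<in>{..N}. \<forall>z\<in>K.
        dist (closure_deriv \<Omega> l (F m) z) (closure_deriv \<Omega> l f z) < \<epsilon>"
      using R K by (intro eventually_ball_finite) (auto simp: uniform_limit_iff)
    moreover have "\<forall>\<^sub>F m in sequentially. F m \<in> A_inf \<Omega>" using R by blast
    ultimately show "\<forall>\<^sub>F m in sequentially. F m \<in> U"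
      by eventually_elim (use U in \<open>auto simp: A_inf_nbhd_def dist_norm\<close>)
  qed
qed

end

theory Submission imports Defs
begin

text \<open>
  If \<open>g\<close> is a polynomial of degree exactly \<open>p\<close>, then at every centre the Hankel matrix of \<open>g\<close> is
  anti-triangular with the nonzero leading coefficient of \<open>g\<close> on the antidiagonal, whatever \<open>q\<close> is, and
  \<open>[p/q]\<close> is \<open>g\<close> itself. Solving the triangular system with explicit bounds shows that for all \<open>f\<close> close
  to \<open>g\<close> the Pade denominators are close to 1, uniformly in the centre, so \<open>[p/q]\<close> of \<open>f\<close> stays
  close to \<open>f\<close> with all derivatives. Such polynomials with \<open>(p, q) \<in> \<F>\<close> are dense: a compact subset of
  the closure of \<open>\<Omega>\<close> keeps its filled holes inside that closure, so Runge's theorem applies, and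
  adding a small multiple of a high power makes the degree exact. Hence the functions that are good on
  the \<open>m\<close>-th set of a compact exhaustion up to \<open>1/(m+1)\<close> for some \<open>(p, q) \<in> \<F>\<close> contain a dense open
  set, and Baire's theorem for the closed subspaces of \<open>A_inf\<close> concludes.
\<close>

section \<open>Runge's theorem for polynomials\<close>

text \<open>Along the sequence in \<open>\<F>\<close> the degrees \<open>q\<close> are arbitrary, so
  the Hankel estimate must work for every \<open>q\<close>. Its constants may depend on
  \<open>q\<close>, because the pair is fixed before the neighbourhood of the polynomial is chosen.
  The growth of \<open>p\<close> enters when a pair with \<open>p\<close> beyond the degree of the
  Runge polynomial is picked. The comparison therefore passes through the entire function g:
  smallness of [p/q] - g on discs of radius 1 about K controls all derivatives on K, and those of g
  and f are close there by the choice of the neighbourhood. Uniformity in the centre comes from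
  re-expanding g at \<zeta>: the top coefficient stays the leading coefficient of g, and the others
  remain bounded while \<zeta> runs through a compact set.\<close>

definition poly_approx :: "complex set \<Rightarrow> (complex \<Rightarrow> complex) set" where
  "poly_approx K = {h. \<forall>\<epsilon>>0. \<exists>p. \<forall>z\<in>K. cmod (h z - poly p z) < \<epsilon>}"

section \<open>The algebra of uniform limits of polynomials on a compact set\<close>

lemma poly_approxD:
  "h \<in> poly_approx K \<Longrightarrow> \<epsilon> > 0 \<Longrightarrow> \<exists>p. \<forall>z\<in>K. cmod (h z - poly p z) < \<epsilon>"
  by (auto simp: poly_approx_def)

lemma poly_in_poly_approx: "poly p \<in> poly_approx K"
  by (auto simp: poly_approx_def intro!: exI[of _ p])

lemma const_in_poly_approx: "(\<lambda>z. c) \<in> poly_approx K"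
proof -
  have "poly [:c:] = (\<lambda>z. c)" by auto
  then show ?thesis using poly_in_poly_approx[of "[:c:]" K] by simp
qed

lemma poly_approx_closed:
  assumes "\<And>\<epsilon>. \<epsilon> > 0 \<Longrightarrow> \<exists>g\<in>poly_approx K. \<forall>z\<in>K. cmod (h z - g z) \<le> \<epsilon>"
  shows "h \<in> poly_approx K"
  unfolding poly_approx_def
proof (intro CollectI allI impI)
  fix \<epsilon> :: real assume "\<epsilon> > 0"
  then obtain g where g: "g \<in> poly_approx K" "\<forall>z\<in>K. cmod (h z - g z) \<le> \<epsilon>/2"
    using assms[of "\<epsilon>/2"] by auto
  obtain p where p: "\<forall>z\<in>K. cmod (g z - poly p z) < \<epsilon>/2"
    using poly_approxD[OF g(1), of "\<epsilon>/2"] \<open>\<epsilon> > 0\<close> by auto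
  show "\<exists>p. \<forall>z\<in>K. cmod (h z - poly p z) < \<epsilon>"
  proof (intro exI ballI)
    fix z assume "z \<in> K"
    have "cmod (h z - poly p z) \<le> cmod (h z - g z) + cmod (g z - poly p z)"
      using norm_triangle_ineq[of "h z - g z" "g z - poly p z"] by simp
    then show "cmod (h z - poly p z) < \<epsilon>" using g(2) p \<open>z \<in> K\<close> by fastforce
  qed
qed

lemma poly_approx_add:
  assumes "f \<in> poly_approx K" "g \<in> poly_approx K"
  shows "(\<lambda>z. f z + g z) \<in> poly_approx K"
  unfolding poly_approx_def
proof (intro CollectI allI impI)
  fix \<epsilon> :: real assume "\<epsilon> > 0"
  then obtain p q where p: "\<forall>z\<in>K. cmod (f z - poly p z) < \<epsilon>/2"
    and q: "\<forall>z\<in>K. cmod (g z - poly q z) < \<epsilon>/2"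
    using assms[THEN poly_approxD, of "\<epsilon>/2"] by auto
  show "\<exists>p. \<forall>z\<in>K. cmod (f z + g z - poly p z) < \<epsilon>"
  proof (intro exI[of _ "p + q"] ballI)
    fix z assume "z \<in> K"
    have "cmod (f z + g z - poly (p + q) z) \<le> cmod (f z - poly p z) + cmod (g z - poly q z)"
      using norm_triangle_ineq[of "f z - poly p z" "g z - poly q z"] by (simp add: algebra_simps)
    then show "cmod (f z + g z - poly (p + q) z) < \<epsilon>" using p q \<open>z \<in> K\<close> by fastforce
  qed
qed

lemma poly_approx_bounded:
  assumes "compact K" "f \<in> poly_approx K"
  obtains M where "M > 0" "\<And>z. z \<in> K \<Longrightarrow> cmod (f z) \<le> M"
proof -
  obtain p where p: "\<forall>z\<in>K. cmod (f z - poly p z) < 1"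
    using poly_approxD[OF assms(2), of 1] by auto
  have "bounded (poly p ` K)"
    using assms(1) by (intro compact_imp_bounded compact_continuous_image continuous_intros)
  then obtain M where M: "M > 0" "\<forall>z\<in>K. cmod (poly p z) \<le> M" by (auto simp: bounded_pos)
  have "cmod (f z) \<le> 1 + M" if "z \<in> K" for z
    using norm_triangle_ineq[of "f z - poly p z" "poly p z"] p M that by fastforce
  then show ?thesis using that[of "1 + M"] M by auto
qed

lemma poly_approx_mult:
  assumes K: "compact K" and f: "f \<in> poly_approx K" and g: "g \<in> poly_approx K"
  shows "(\<lambda>z. f z * g z) \<in> poly_approx K"
  unfolding poly_approx_def
proof (intro CollectI allI impI)
  fix \<epsilon> :: real assume e: "\<epsilon> > 0"
  obtain M where M: "M > 0" "\<And>z. z \<in> K \<Longrightarrow> cmod (f z) \<le> M"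
    using poly_approx_bounded[OF K f] by blast
  obtain q where q: "\<forall>z\<in>K. cmod (g z - poly q z) < \<epsilon>/(2*M)"
    using poly_approxD[OF g, of "\<epsilon>/(2*M)"] e M by auto
  obtain N where N: "N > 0" "\<And>z. z \<in> K \<Longrightarrow> cmod (poly q z) \<le> N"
    using poly_approx_bounded[OF K poly_in_poly_approx] by blast
  obtain p where p: "\<forall>z\<in>K. cmod (f z - poly p z) < \<epsilon>/(2*N)"
    using poly_approxD[OF f, of "\<epsilon>/(2*N)"] e N by auto
  show "\<exists>p. \<forall>z\<in>K. cmod (f z * g z - poly p z) < \<epsilon>"
  proof (intro exI[of _ "p * q"] ballI)
    fix z assume z: "z \<in> K"
    have "f z * g z - poly (p * q) z = f z * (g z - poly q z) + (f z - poly p z) * poly q z"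
      by (simp add: algebra_simps)
    then have "cmod (f z * g z - poly (p * q) z) \<le>
        cmod (f z) * cmod (g z - poly q z) + cmod (f z - poly p z) * cmod (poly q z)"
      using norm_triangle_ineq[of "f z * (g z - poly q z)" "(f z - poly p z) * poly q z"]
      by (simp add: norm_mult)
    also have "\<dots> < M * (\<epsilon>/(2*M)) + (\<epsilon>/(2*N)) * N"
    proof (rule add_le_less_mono)
      show "cmod (f z) * cmod (g z - poly q z) \<le> M * (\<epsilon>/(2*M))"
        using q M z by (intro mult_mono) (auto simp: less_imp_le)
      have "cmod (f z - poly p z) * cmod (poly q z) \<le> cmod (f z - poly p z) * N"
        using N z by (intro mult_left_mono) auto
      also have "\<dots> < (\<epsilon>/(2*N)) * N" using p N z by (intro mult_strict_right_mono) auto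
      finally show "cmod (f z - poly p z) * cmod (poly q z) < (\<epsilon>/(2*N)) * N" .
    qed
    also have "\<dots> = \<epsilon>" using M N by simp
    finally show "cmod (f z * g z - poly (p * q) z) < \<epsilon>" .
  qed
qed

lemma poly_approx_sum:
  assumes "\<And>i. i \<in> I \<Longrightarrow> f i \<in> poly_approx K"
  shows "(\<lambda>z. \<Sum>i\<in>I. f i z) \<in> poly_approx K"
proof (cases "finite I")
  case True
  from this assms show ?thesis
    by (induction I) (auto intro: const_in_poly_approx poly_approx_add)
qed (simp add: const_in_poly_approx)

lemma poly_approx_power:
  "compact K \<Longrightarrow> f \<in> poly_approx K \<Longrightarrow> (\<lambda>z. f z ^ n) \<in> poly_approx K"
  by (induction n) (auto intro: const_in_poly_approx poly_approx_mult)

text \<open>Exact remainder after m terms of the expansion of 1/(y - x) in powers of x/y. An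
  identity in place of a limit gives a uniform error bound directly.\<close>

lemma sum_geometric_quotient:
  fixes x y :: complex
  assumes "y \<noteq> 0" "y \<noteq> x"
  shows "1 / (y - x) - (\<Sum>n<m. x ^ n * (1 / y) ^ Suc n) = (x / y) ^ m / (y - x)"
proof (induction m)
  case (Suc m)
  have "(x / y) ^ m / (y - x) - x ^ m * (1 / y) ^ Suc m = (x / y) ^ Suc m / (y - x)"
    using assms by (simp add: field_simps)
  with Suc show ?case by (simp add: algebra_simps)
qed simp

text \<open>The ratio x/y is at most 1/2 in modulus on \<open>K\<close>, so the geometric series
  converges uniformly and its partial sums stay in the algebra. It has two uses: a constant
  \<open>x\<close> displaces the pole of \<open>1 / y\<close>, and a constant \<open>y\<close>
  expands a far pole in powers of z.\<close>

lemma poly_approx_geometric: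
  assumes K: "compact K" and x: "x \<in> poly_approx K" and y: "(\<lambda>z. 1 / y z) \<in> poly_approx K"
    and d: "d > 0" "\<And>z. z \<in> K \<Longrightarrow> d \<le> cmod (y z)"
    and half: "\<And>z. z \<in> K \<Longrightarrow> cmod (x z) \<le> cmod (y z) / 2"
  shows "(\<lambda>z. 1 / (y z - x z)) \<in> poly_approx K"
proof (rule poly_approx_closed)
  fix \<epsilon> :: real assume "\<epsilon> > 0"
  then obtain m where m: "(1/2) ^ m < \<epsilon> * (d/2)"
    using real_arch_pow_inv[of "\<epsilon> * (d/2)" "1/2"] d by auto
  show "\<exists>g\<in>poly_approx K. \<forall>z\<in>K. cmod (1 / (y z - x z) - g z) \<le> \<epsilon>"
  proof (intro bexI ballI)
    fix z assume z: "z \<in> K"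
    have y0: "cmod (y z) > 0" using d(1) d(2)[OF z] by linarith
    have diff: "cmod (y z - x z) \<ge> d/2"
      using norm_triangle_ineq2[of "y z" "x z"] half[OF z] d(2)[OF z] by linarith
    have "y z \<noteq> 0" "y z \<noteq> x z" using y0 diff d(1) by auto
    note geom = sum_geometric_quotient[OF this]
    have "cmod (1 / (y z - x z) - (\<Sum>n<m. x z ^ n * (1 / y z) ^ Suc n)) =
        (cmod (x z) / cmod (y z)) ^ m / cmod (y z - x z)"
      unfolding geom by (simp add: norm_divide norm_power)
    also have "\<dots> \<le> (1/2) ^ m / (d/2)"
    proof (rule frac_le)
      have "cmod (x z) / cmod (y z) \<le> 1 / 2" using half[OF z] y0 by (simp add: field_simps)
      then show "(cmod (x z) / cmod (y z)) ^ m \<le> (1 / 2) ^ m" by (rule power_mono) simp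
    qed (use d(1) diff in auto)
    also have "\<dots> \<le> \<epsilon>" using m d(1) by (simp add: field_simps)
    finally show "cmod (1 / (y z - x z) - (\<Sum>n<m. x z ^ n * (1 / y z) ^ Suc n)) \<le> \<epsilon>" .
  next
    show "(\<lambda>z. \<Sum>n<m. x z ^ n * (1 / y z) ^ Suc n) \<in> poly_approx K"
      by (intro poly_approx_sum poly_approx_mult poly_approx_power K x y)
  qed
qed

text \<open>Pole pushing: a pole far from \<open>K\<close> is handled by a power series about 0, and
  connectedness of \<open>- K\<close> carries it to any other place off \<open>K\<close>.\<close>

lemma pole_in_poly_approx:
  assumes K: "compact K" and conn: "connected (- K)" and w: "w \<notin> K"
  shows "(\<lambda>z. 1 / (w - z)) \<in> poly_approx K"
proof (cases "K = {}")
  case True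
  then show ?thesis by (simp add: poly_approx_def)
next
  case False
  define W where "W = {w \<in> - K. (\<lambda>z. 1 / (w - z)) \<in> poly_approx K}"
  have move: "w' \<in> W" if w: "w \<in> W" and w': "w' \<notin> K"
    and half: "\<And>z. z \<in> K \<Longrightarrow> cmod (w - w') \<le> cmod (w - z) / 2" for w w'
  proof -
    have "setdist {w} K > 0"
      using w K by (auto simp: W_def setdist_gt_0_compact_closed compact_imp_closed False)
    moreover have "setdist {w} K \<le> cmod (w - z)" if "z \<in> K" for z
      using setdist_le_dist[of w "{w}" z K] that by (simp add: dist_norm)
    ultimately have "(\<lambda>z. 1 / ((w - z) - (w - w'))) \<in> poly_approx K"
      using w half by (intro poly_approx_geometric[OF K const_in_poly_approx]) (auto simp: W_def)
    then show ?thesis using w' by (simp add: W_def)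
  qed
  \<comment> \<open>A nearby pole is expanded into a geometric series in the old one, so \<open>W\<close> is both open and closed in \<open>- K\<close>.\<close>
  have near: "\<exists>e>0. \<forall>w. dist w v < e \<longrightarrow> w \<notin> K \<and> (w \<in> W \<longleftrightarrow> v \<in> W)" if v: "v \<notin> K" for v
  proof -
    have "open (- K)" using K by (simp add: compact_imp_closed open_Compl)
    then obtain d where d: "d > 0" "ball v d \<subseteq> - K"
      using v by (metis ComplI openE)
    \<comment> \<open>The radius d/4 serves both directions: points of \<open>K\<close> have
      distance at least 3*d/4 from w, so the ratio stays below one half whether w is expanded about
      v or v about w.\<close>
    show ?thesis
    proof (intro exI[of _ "d/4"] conjI allI impI)
      fix w assume w: "dist w v < d/4"
      have far: "d \<le> cmod (v - z)" if "z \<in> K" for z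
        using d that by (force simp: dist_norm)
      have wv: "cmod (w - v) < d/4" using w by (simp add: dist_norm)
      have far': "cmod (w - z) \<ge> 3*d/4" if "z \<in> K" for z
        using far[OF that] wv norm_triangle_ineq[of "v - w" "w - z"]
        by (simp add: norm_minus_commute)
      show wK: "w \<notin> K" using far' d(1) by fastforce
      show "w \<in> W \<longleftrightarrow> v \<in> W"
      proof
        assume "w \<in> W"
        moreover have "cmod (w - v) \<le> cmod (w - z) / 2" if "z \<in> K" for z
          using wv far'[OF that] d(1) by linarith
        ultimately show "v \<in> W" using move v by blast
      next
        assume "v \<in> W"
        moreover have "cmod (v - w) \<le> cmod (v - z) / 2" if "z \<in> K" for z
          using wv far[OF that] d(1) by (simp add: norm_minus_commute)
        ultimately show "w \<in> W" using move wK by blast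
      qed
    qed (use d in auto)
  qed
  have "open W" unfolding open_dist
  proof
    fix v assume "v \<in> W"
    then show "\<exists>e>0. \<forall>w. dist w v < e \<longrightarrow> w \<in> W" using near[of v] by (auto simp: W_def)
  qed
  have "open (- K - W)" unfolding open_dist
  proof
    fix v assume "v \<in> - K - W"
    then show "\<exists>e>0. \<forall>w. dist w v < e \<longrightarrow> w \<in> - K - W" using near[of v] by auto
  qed
  obtain R where R: "R > 0" "\<And>z. z \<in> K \<Longrightarrow> cmod z \<le> R"
    using compact_imp_bounded[OF K] by (auto simp: bounded_pos)
  \<comment> \<open>Modulus 2 * R makes |z| at most half of |v| on \<open>K\<close>.\<close>
  define v where "v = complex_of_real (2 * R)"
  have nv: "cmod v = 2 * R" using R by (simp add: v_def norm_mult)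
  have "v \<notin> K" using R(1) R(2)[of v] nv by auto
  moreover have "(\<lambda>z. 1 / (v - z)) \<in> poly_approx K"
  proof (rule poly_approx_geometric[OF K _ const_in_poly_approx, where d = R])
    have "poly [:0, 1:] = (\<lambda>z :: complex. z)" by auto
    then show "(\<lambda>z. z) \<in> poly_approx K" using poly_in_poly_approx[of "[:0, 1:]" K] by simp
  qed (use R nv in auto)
  ultimately have "v \<in> W" by (simp add: W_def)
  have "- K \<subseteq> W"
  proof (rule ccontr)
    assume "\<not> - K \<subseteq> W"
    moreover have "W \<subseteq> - K" by (auto simp: W_def)
    ultimately show False
      using connectedD[OF conn \<open>open W\<close> \<open>open (- K - W)\<close>] \<open>v \<in> W\<close> by blast
  qed
  then show ?thesis using w by (auto simp: W_def)
qed

section \<open>Cauchy integrals over segments and over a grid of squares\<close>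

lemma integral_in_poly_approx:
  fixes \<phi> :: "real \<Rightarrow> complex \<Rightarrow> complex"
  assumes K: "compact K" and cont: "continuous_on ({0..1} \<times> K) (\<lambda>(t, z). \<phi> t z)"
    and \<phi>: "\<And>t. t \<in> {0..1} \<Longrightarrow> \<phi> t \<in> poly_approx K"
  shows "(\<lambda>z. integral {0..1} (\<lambda>t. \<phi> t z)) \<in> poly_approx K"
proof (rule poly_approx_closed)
  fix \<epsilon> :: real assume e: "\<epsilon> > 0"
  have "uniformly_continuous_on ({0..1} \<times> K) (\<lambda>(t, z). \<phi> t z)"
    using K cont by (intro compact_uniformly_continuous compact_Times) auto
  then obtain \<delta> where d: "\<delta> > 0"
    and close: "\<And>t s z. t \<in> {0..1} \<Longrightarrow> s \<in> {0..1} \<Longrightarrow> z \<in> K \<Longrightarrow> dist t s < \<delta> \<Longrightarrow>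
      dist (\<phi> t z) (\<phi> s z) < \<epsilon>"
    unfolding uniformly_continuous_on_def using e by (fastforce simp: dist_Pair_Pair)
  obtain n where n: "n > 0" "1 / real n < \<delta>"
    using real_arch_inverse[of \<delta>] d by (auto simp: inverse_eq_divide)
  \<comment> \<open>Left-endpoint Riemann sum over the first k of n intervals. Uniform continuity on
    the compact product makes the error at most \<epsilon> per unit length, uniformly in z, and
    induction on k adds up the intervals.\<close>
  define S where "S k z = (\<Sum>i<k. \<phi> (real i / n) z * (1 / n))" for k z
  show "\<exists>g\<in>poly_approx K. \<forall>z\<in>K. cmod (integral {0..1} (\<lambda>t. \<phi> t z) - g z) \<le> \<epsilon>"
  proof (intro bexI[of _ "S n"] ballI)
    show "S n \<in> poly_approx K"
      unfolding S_def using n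
      by (intro poly_approx_sum poly_approx_mult[OF K] \<phi> const_in_poly_approx) auto
    fix z assume z: "z \<in> K"
    have cz: "continuous_on {0..1} (\<lambda>t. \<phi> t z)"
    proof -
      have "continuous_on {0..1} (\<lambda>t. case (t, z) of (t, z) \<Rightarrow> \<phi> t z)"
        using z by (intro continuous_on_compose2[OF cont]) (auto intro!: continuous_intros)
      then show ?thesis by simp
    qed
    have "cmod (integral {0..real k / n} (\<lambda>t. \<phi> t z) - S k z) \<le> \<epsilon> * (real k / n)" if "k \<le> n" for k
      using that
    proof (induction k)
      case (Suc k)
      let ?a = "real k / n" and ?b = "real (Suc k) / n"
      have ab: "0 \<le> ?a" "?a \<le> ?b" "?b \<le> 1" "?b - ?a = 1 / n"
        using Suc.prems n by (auto simp: field_simps)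
      have int: "(\<lambda>t. \<phi> t z) integrable_on {0..?b}"
        using ab by (intro integrable_continuous_real continuous_on_subset[OF cz]) auto
      have int': "(\<lambda>t. \<phi> t z) integrable_on {?a..?b}"
        using ab by (intro integrable_continuous_real continuous_on_subset[OF cz]) auto
      have split: "integral {0..?b} (\<lambda>t. \<phi> t z) = integral {0..?a} (\<lambda>t. \<phi> t z) + integral {?a..?b} (\<lambda>t. \<phi> t z)"
        using Henstock_Kurzweil_Integration.integral_combine[OF ab(1,2) int] by simp
      have "integral {?a..?b} (\<lambda>t. \<phi> t z) - \<phi> ?a z * (1 / n) =
          integral {?a..?b} (\<lambda>t. \<phi> t z - \<phi> ?a z)"
        using int' ab by (subst integral_diff) (auto simp: content_real scaleR_conv_of_real)
      also have "cmod \<dots> \<le> \<epsilon> * (?b - ?a)"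
      proof (rule integral_bound[OF ab(2)])
        show "continuous_on {?a..?b} (\<lambda>t. \<phi> t z - \<phi> ?a z)"
          using ab by (intro continuous_on_diff continuous_on_const continuous_on_subset[OF cz]) auto
        fix t assume t: "t \<in> {?a..?b}"
        have "dist t ?a < \<delta>" using t ab n by (auto simp: dist_real_def)
        moreover have "t \<in> {0..1}" using t ab by (metis atLeastAtMost_iff order_trans)
        ultimately have "dist (\<phi> t z) (\<phi> ?a z) < \<epsilon>" using ab z by (intro close) auto
        then show "cmod (\<phi> t z - \<phi> ?a z) \<le> \<epsilon>" by (simp add: dist_norm)
      qed
      finally have "cmod (integral {?a..?b} (\<lambda>t. \<phi> t z) - \<phi> ?a z * (1 / n)) \<le> \<epsilon> * (1 / n)"
        unfolding ab(4) .
      moreover have "integral {0..?b} (\<lambda>t. \<phi> t z) - S (Suc k) z =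
         (integral {0..?a} (\<lambda>t. \<phi> t z) - S k z) + (integral {?a..?b} (\<lambda>t. \<phi> t z) - \<phi> ?a z * (1 / n))"
        unfolding split by (simp add: S_def)
      ultimately have "cmod (integral {0..?b} (\<lambda>t. \<phi> t z) - S (Suc k) z) \<le> \<epsilon> * ?a + \<epsilon> * (1 / n)"
        using Suc by (metis Suc_leD add_mono norm_triangle_le)
      also have "\<dots> = \<epsilon> * ?b" by (simp add: add_divide_distrib algebra_simps)
      finally show ?case .
    qed (simp add: S_def)
    from this[of n] show "cmod (integral {0..1} (\<lambda>t. \<phi> t z) - S n z) \<le> \<epsilon>" using n by simp
  qed
qed

text \<open>For fixed t the integrand is a constant multiple of a Cauchy kernel with its pole off
  \<open>K\<close>, so pole pushing and then integration over t apply.\<close>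

lemma linepath_integral_in_poly_approx:
  assumes K: "compact K" and conn: "connected (- K)"
    and f: "continuous_on (closed_segment a b) f" and ab: "closed_segment a b \<inter> K = {}"
  shows "(\<lambda>z. contour_integral (linepath a b) (\<lambda>w. f w / (w - z))) \<in> poly_approx K"
proof -
  have seg: "linepath a b t \<in> closed_segment a b" if "t \<in> {0..1}" for t
    using that linepath_image_01 by blast
  have "(\<lambda>z. integral {0..1} (\<lambda>t. f (linepath a b t) * (b - a) * (1 / (linepath a b t - z)))) \<in> poly_approx K"
  proof (rule integral_in_poly_approx[OF K])
    have "continuous_on ({0..1} \<times> K) (\<lambda>x. f (linepath a b (fst x)))"
      by (rule continuous_on_compose2[OF f]) (auto intro!: continuous_on_compose2[OF continuous_on_linepath] continuous_intros seg)
    moreover have "linepath a b t - z \<noteq> 0" if "t \<in> {0..1}" "z \<in> K" for t z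
      using seg[OF that(1)] ab that(2) by auto
    ultimately show "continuous_on ({0..1} \<times> K)
        (\<lambda>(t, z). f (linepath a b t) * (b - a) * (1 / (linepath a b t - z)))"
      unfolding case_prod_unfold by (intro continuous_intros continuous_on_compose2[OF continuous_on_linepath]) auto
    fix t :: real assume "t \<in> {0..1}"
    then show "(\<lambda>z. f (linepath a b t) * (b - a) * (1 / (linepath a b t - z))) \<in> poly_approx K"
      using seg ab by (intro poly_approx_mult[OF K const_in_poly_approx] pole_in_poly_approx[OF K conn]) auto
  qed
  then show ?thesis
    unfolding contour_integral_integral by (simp add: mult.commute mult.left_commute divide_inverse)
qed

text \<open>Reversing the top and left sides makes every side point right or up. A side shared by
  two squares of a grid then yields the same integral in both, with opposite signs.\<close>

lemma contour_integral_rectpath: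
  assumes "continuous_on (path_image (rectpath a b)) F"
  shows "contour_integral (rectpath a b) F =
    contour_integral (linepath a (Complex (Re b) (Im a))) F +
    contour_integral (linepath (Complex (Re b) (Im a)) b) F -
    contour_integral (linepath (Complex (Re a) (Im b)) b) F -
    contour_integral (linepath a (Complex (Re a) (Im b))) F"
proof -
  define c d where "c = Complex (Re b) (Im a)" and "d = Complex (Re a) (Im b)"
  have rp: "rectpath a b = linepath a c +++ linepath c b +++ linepath b d +++ linepath d a"
    by (simp add: rectpath_def Let_def c_def d_def)
  have cont: "continuous_on (closed_segment a c) F" "continuous_on (closed_segment c b) F"
    "continuous_on (closed_segment b d) F" "continuous_on (closed_segment d a) F"
    using assms by (auto simp: rp path_image_join elim: continuous_on_subset)
  have int: "F contour_integrable_on linepath a c" "F contour_integrable_on linepath c b"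
    "F contour_integrable_on linepath b d" "F contour_integrable_on linepath d a"
    using cont by (auto intro: contour_integrable_continuous_linepath)
  have "contour_integral (linepath b d) F = - contour_integral (linepath d b) F"
    "contour_integral (linepath d a) F = - contour_integral (linepath a d) F"
    using cont by (auto intro: contour_integral_reverse_linepath)
  then show ?thesis
    using int by (simp add: rp contour_integrable_join flip: c_def d_def)
qed

text \<open>This carries Cauchy's formula from open squares to points on grid lines, once the
  remaining segments are known to miss \<open>K\<close>.\<close>

lemma isCont_Cauchy_linepath:
  assumes f: "continuous_on (closed_segment a b) f" and z: "z \<notin> closed_segment a b"
  shows "isCont (\<lambda>z. contour_integral (linepath a b) (\<lambda>w. f w / (w - z))) z"
proof -
  have "((\<lambda>z. contour_integral (linepath a b) (\<lambda>w. f w / (w - z))) has_field_derivative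
      of_nat 1 * contour_integral (linepath a b) (\<lambda>u. f u / (u - z) ^ Suc 1)) (at z)"
  proof (rule Cauchy_next_derivative(2)[where S = UNIV and B = "cmod (b - a)"])
    fix w assume "w \<in> UNIV - path_image (linepath a b)"
    then have "continuous_on (closed_segment a b) (\<lambda>u. f u / (u - w) ^ 1)"
      using f by (intro continuous_intros) auto
    then show "((\<lambda>u. f u / (u - w) ^ 1) has_contour_integral
        contour_integral (linepath a b) (\<lambda>u. f u / (u - w))) (linepath a b)"
      using contour_integrable_continuous_linepath has_contour_integral_integral by fastforce
  qed (use f z in auto)
  then show ?thesis by (rule DERIV_isCont)
qed

text \<open>The common part of the index sets cancels; for the sides of grid squares this removes
  those shared by two squares.\<close>

lemma sum_diff_sum:
  fixes h :: "'a \<Rightarrow> 'b :: ab_group_add"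
  assumes "finite A" "finite B"
  shows "sum h A - sum h B = sum h (A - B) - sum h (B - A)"
  using sum.Int_Diff[OF assms(1), of h B] sum.Int_Diff[OF assms(2), of h A]
  by (simp add: Int_commute)

text \<open>On \<open>K\<close> the function is a Cauchy integral over the sides belonging to
  exactly one of the small grid squares that meet \<open>K\<close>. These segments lie in
  \<open>V\<close> and miss \<open>K\<close>, so pole pushing applies to their kernels.\<close>

theorem Runge_polynomial:
  assumes K: "compact K" and conn: "connected (- K)" and V: "open V" "K \<subseteq> V"
    and f: "f holomorphic_on V"
  shows "f \<in> poly_approx K"
proof -
  obtain e where e: "e > 0" "(\<Union>x\<in>K. cball x e) \<subseteq> V"
    using compact_subset_open_imp_cball_epsilon_subset[OF K V] by blast
  \<comment> \<open>Two points of a square of side d differ by at most d in each coordinate, hence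
    by at most 2 * d = e, so a square meeting \<open>K\<close> stays in \<open>V\<close>.\<close>
  define d where "d = e / 2"
  have d: "d > 0" "2 * d = e" using e by (auto simp: d_def)
  define c where "c m n = Complex (d * real_of_int m) (d * real_of_int n)" for m n
  define sq where "sq x = (case x of (m, n) \<Rightarrow> cbox (c m n) (c (m+1) (n+1)))" for x
  \<comment> \<open>Bottom and left side of the square x; its top and right sides are
    \<open>hs (up x)\<close> and \<open>vs (right x)\<close>. A grid segment thus has a single index
    even when two squares share it.\<close>
  define hs vs where "hs x = (case x of (m, n) \<Rightarrow> closed_segment (c m n) (c (m+1) n))"
    and "vs x = (case x of (m, n) \<Rightarrow> closed_segment (c m n) (c m (n+1)))" for x
  define H where "H z x = (case x of (m, n) \<Rightarrow>
      contour_integral (linepath (c m n) (c (m+1) n)) (\<lambda>w. f w / (w - z)))" for z x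
  define U where "U z x = (case x of (m, n) \<Rightarrow>
      contour_integral (linepath (c m n) (c m (n+1))) (\<lambda>w. f w / (w - z)))" for z x
  define up right where "up = (\<lambda>(m :: int, n :: int). (m, n + 1))"
    and "right = (\<lambda>(m :: int, n :: int). (m + 1, n))"
  define S where "S = {x. sq x \<inter> K \<noteq> {}}"
  have contf: "continuous_on V f" using f by (rule holomorphic_on_imp_continuous_on)
  have mem_sq: "w \<in> sq (m, n) \<longleftrightarrow> d * m \<le> Re w \<and> Re w \<le> d * (m + 1) \<and> d * n \<le> Im w \<and> Im w \<le> d * (n + 1)"
    for w m n by (auto simp: sq_def c_def in_cbox_complex_iff)
  have convex_sq: "convex (sq x)" for x by (cases x) (auto simp: sq_def)
  have sqV: "sq x \<subseteq> V" if "x \<in> S" for x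
  proof
    fix w assume w: "w \<in> sq x"
    obtain m n where x: "x = (m, n)" by (cases x)
    obtain k where k: "k \<in> K" "k \<in> sq x" using \<open>x \<in> S\<close> by (auto simp: S_def)
    have "\<bar>Re (k - w)\<bar> \<le> d" "\<bar>Im (k - w)\<bar> \<le> d"
      using w k(2) by (auto simp: x mem_sq algebra_simps)
    then have "dist k w \<le> e" using cmod_le[of "k - w"] d by (simp add: dist_norm)
    then have "w \<in> cball k e" by simp
    then show "w \<in> V" using e(2) k(1) by blast
  qed
  have seg: "hs x \<subseteq> sq x" "vs x \<subseteq> sq x" "hs (up x) \<subseteq> sq x" "vs (right x) \<subseteq> sq x" for x
  proof -
    obtain m n where x: "x = (m, n)" by (cases x)
    show "hs x \<subseteq> sq x" "vs x \<subseteq> sq x" "hs (up x) \<subseteq> sq x" "vs (right x) \<subseteq> sq x"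
      unfolding hs_def vs_def x up_def right_def prod.case using d(1)
      by (intro closed_segment_subset convex_sq; simp add: mem_sq c_def)+
  qed
  have injs: "inj up" "inj right" by (auto simp: inj_on_def up_def right_def)
  have finS: "finite S"
  proof -
    obtain R where R: "\<And>z. z \<in> K \<Longrightarrow> cmod z \<le> R"
      using compact_imp_bounded[OF K] by (auto simp: bounded_iff)
    define N where "N = \<lceil>R / d\<rceil> + 1"
    have RN: "R / d \<le> real_of_int N - 1" by (simp add: N_def)
    have bound: "j \<in> {-N..N}" if "d * real_of_int j \<le> t" "t \<le> d * (real_of_int j + 1)" "\<bar>t\<bar> \<le> R" for t j
    proof -
      have "d * real_of_int j \<le> R" "- R \<le> d * (real_of_int j + 1)" using that by linarith+
      then have "real_of_int j \<le> R / d" "- (R / d) \<le> real_of_int j + 1"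
        using d(1) by (auto simp: field_simps)
      then show ?thesis using RN by auto
    qed
    have "S \<subseteq> {-N..N} \<times> {-N..N}"
    proof
      fix x assume "x \<in> S"
      obtain m n where x: "x = (m, n)" by (cases x)
      obtain k where k: "k \<in> K" "k \<in> sq (m, n)" using \<open>x \<in> S\<close> by (auto simp: S_def x)
      have "\<bar>Re k\<bar> \<le> R" "\<bar>Im k\<bar> \<le> R"
        using R[OF k(1)] abs_Re_le_cmod[of k] abs_Im_le_cmod[of k] by linarith+
      then show "x \<in> {-N..N} \<times> {-N..N}"
        using bound[of m "Re k"] bound[of n "Im k"] k(2) unfolding x mem_sq by simp
    qed
    then show ?thesis by (rule finite_subset) auto
  qed
  \<comment> \<open>Sides of the squares meeting \<open>K\<close> that are not shared by two such squares; they miss \<open>K\<close>.\<close>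
  define EH EV where "EH = (S - up ` S) \<union> (up ` S - S)" and "EV = (S - right ` S) \<union> (right ` S - S)"
  have EH: "hs x \<subseteq> V \<and> hs x \<inter> K = {}" if "x \<in> EH" for x
  proof -
    obtain y where y: "x = up y"
      by (metis (no_types, lifting) case_prod_conv diff_add_cancel surj_pair up_def)
    \<comment> \<open>Of the two squares sharing this side exactly one meets \<open>K\<close>: that
      one places the side in \<open>V\<close>, the other one keeps it off \<open>K\<close>.\<close>
    have "(x \<in> S \<and> y \<notin> S) \<or> (x \<notin> S \<and> y \<in> S)"
      using that injs(1) unfolding EH_def y by (auto dest: injD)
    then show ?thesis using sqV seg(1)[of x] seg(3)[of y] unfolding S_def y by blast
  qed
  have EV: "vs x \<subseteq> V \<and> vs x \<inter> K = {}" if "x \<in> EV" for x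
  proof -
    obtain y where y: "x = right y"
      by (metis (no_types, lifting) case_prod_conv diff_add_cancel surj_pair right_def)
    have "(x \<in> S \<and> y \<notin> S) \<or> (x \<notin> S \<and> y \<in> S)"
      using that injs(2) unfolding EV_def y by (auto dest: injD)
    then show ?thesis using sqV seg(2)[of x] seg(4)[of y] unfolding S_def y by blast
  qed
  \<comment> \<open>The signs are those of counterclockwise boundaries: bottom and right sides count
    positively, top and left sides negatively.\<close>
  define G where "G z = (\<Sum>x\<in>S - up ` S. H z x) + (\<Sum>x\<in>up ` S - S. - H z x)
      + ((\<Sum>x\<in>right ` S - S. U z x) + (\<Sum>x\<in>S - right ` S. - U z x))" for z

  have Happ: "(\<lambda>z. H z x) \<in> poly_approx K" if "x \<in> EH" for x
    using EH[OF that] unfolding H_def hs_def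
    by (cases x) (auto intro!: linepath_integral_in_poly_approx K conn continuous_on_subset[OF contf])
  have Uapp: "(\<lambda>z. U z x) \<in> poly_approx K" if "x \<in> EV" for x
    using EV[OF that] unfolding U_def vs_def
    by (cases x) (auto intro!: linepath_integral_in_poly_approx K conn continuous_on_subset[OF contf])
  have neg: "(\<lambda>z. - h z) \<in> poly_approx K" if "h \<in> poly_approx K" for h
    using poly_approx_mult[OF K const_in_poly_approx[of "-1"] that] by simp
  have G: "G \<in> poly_approx K"
    unfolding G_def by (intro poly_approx_add poly_approx_sum neg Happ Uapp) (auto simp: EH_def EV_def)

  have on_box: "2 * pi * \<i> * f z = G z" if z: "z \<in> box (c m n) (c (m+1) (n+1))" "(m, n) \<in> S" for z m n
  proof -
    have rect: "contour_integral (rectpath (c k l) (c (k+1) (l+1))) (\<lambda>w. f w / (w - z))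
        = H z (k, l) + U z (right (k, l)) - H z (up (k, l)) - U z (k, l)"
      and val: "contour_integral (rectpath (c k l) (c (k+1) (l+1))) (\<lambda>w. f w / (w - z))
        = (if (k, l) = (m, n) then 2 * pi * \<i> * f z else 0)"
      if kl: "(k, l) \<in> S" for k l
    proof -
      let ?r = "rectpath (c k l) (c (k+1) (l+1))"
      have le: "Re (c k l) \<le> Re (c (k+1) (l+1))" "Im (c k l) \<le> Im (c (k+1) (l+1))"
        using d by (auto simp: c_def algebra_simps)
      have sub: "path_image ?r \<subseteq> sq (k, l)"
        unfolding sq_def using path_image_rectpath_subset_cbox[OF le] by simp
      \<comment> \<open>An open square meets no other closed square of the grid: the strict
        inequalities hold between integers and force equal indices.\<close>
      have zn: "z \<notin> sq (k, l)" if "(k, l) \<noteq> (m, n)"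
      proof
        assume "z \<in> sq (k, l)"
        then have "d * k < d * (m + 1)" "d * m < d * (k + 1)" "d * l < d * (n + 1)" "d * n < d * (l + 1)"
          using z(1) by (auto simp: mem_sq in_box_complex_iff c_def)
        then have "k < m + 1" "m < k + 1" "l < n + 1" "n < l + 1"
          using d(1) by (auto simp: mult_less_cancel_left_pos)
        then show False using that by auto
      qed
      have zp: "z \<notin> path_image ?r"
      proof (cases "(k, l) = (m, n)")
        case True
        then show ?thesis using path_image_rectpath_inter_box[OF le] z(1) by auto
      qed (use zn sub in blast)
      have "continuous_on (path_image ?r) (\<lambda>w. f w / (w - z))"
        using zp sub sqV[OF kl]
        by (intro continuous_on_divide continuous_on_diff continuous_on_id continuous_on_const
            continuous_on_subset[OF contf]) auto
      from contour_integral_rectpath[OF this]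
      show "contour_integral ?r (\<lambda>w. f w / (w - z)) = H z (k, l) + U z (right (k, l)) - H z (up (k, l)) - U z (k, l)"
        by (simp add: H_def U_def up_def right_def c_def)
      show "contour_integral ?r (\<lambda>w. f w / (w - z)) = (if (k, l) = (m, n) then 2 * pi * \<i> * f z else 0)"
      proof (cases "(k, l) = (m, n)")
        case True
        have "((\<lambda>w. f w / (w - z)) has_contour_integral (2*pi * \<i> * winding_number ?r z * f z)) ?r"
        proof (rule Cauchy_integral_formula_convex_simple[OF convex_sq[of "(k, l)"]])
          show "f holomorphic_on sq (k, l)" using f sqV[OF kl] by (rule holomorphic_on_subset)
          show "z \<in> interior (sq (k, l))" using z(1) True by (simp add: sq_def interior_cbox)
        qed (use sub zp in auto)
        moreover have "winding_number ?r z = 1" using winding_number_rectpath[of z] z(1) True by simp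
        ultimately show ?thesis using True by (simp add: contour_integral_unique)
      next
        case False
        have "((\<lambda>w. f w / (w - z)) has_contour_integral 0) ?r"
        proof (rule Cauchy_theorem_convex_simple[OF _ convex_sq[of "(k, l)"]])
          show "(\<lambda>w. f w / (w - z)) holomorphic_on sq (k, l)"
            using sqV[OF kl] zn[OF False]
            by (intro holomorphic_on_divide holomorphic_on_diff holomorphic_on_ident
                holomorphic_on_const holomorphic_on_subset[OF f]) auto
        qed (use sub in auto)
        then show ?thesis using False by (auto simp: contour_integral_unique)
      qed
    qed
    have "2 * pi * \<i> * f z = (\<Sum>x\<in>S. if x = (m, n) then 2 * pi * \<i> * f z else 0)"
      using finS z(2) by simp
    also have "\<dots> = (\<Sum>x\<in>S. H z x + U z (right x) - H z (up x) - U z x)"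
    proof (rule sum.cong[OF refl])
      fix x assume "x \<in> S"
      obtain k l where x: "x = (k, l)" by (cases x)
      show "(if x = (m, n) then 2 * pi * \<i> * f z else 0) = H z x + U z (right x) - H z (up x) - U z x"
        using rect[of k l] val[of k l] \<open>x \<in> S\<close> by (simp only: x)
    qed
    \<comment> \<open>Top and right sides are reindexed through the injections \<open>up\<close> and
      \<open>right\<close>, which turns a sum over squares into signed sums over sides.\<close>
    also have "\<dots> = (sum (H z) S - sum (H z) (up ` S)) + (sum (U z) (right ` S) - sum (U z) S)"
      using injs by (simp add: sum.distrib sum_subtractf sum.reindex inj_on_subset)
    also have "\<dots> = G z"
      using finS by (subst (1 2) sum_diff_sum) (auto simp: G_def sum_negf)
    finally show ?thesis .
  qed

  \<comment> \<open>By continuity the formula extends to the points of \<open>K\<close> on grid lines.\<close>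
  have "2 * pi * \<i> * f z = G z" if z: "z \<in> K" for z
  proof -
    have isH: "isCont (\<lambda>z. H z x) z" if "x \<in> EH" for x
      using EH[OF that] z unfolding H_def hs_def
      by (cases x) (auto intro!: isCont_Cauchy_linepath continuous_on_subset[OF contf])
    have isU: "isCont (\<lambda>z. U z x) z" if "x \<in> EV" for x
      using EV[OF that] z unfolding U_def vs_def
      by (cases x) (auto intro!: isCont_Cauchy_linepath continuous_on_subset[OF contf])
    have "isCont G z"
      unfolding G_def by (intro continuous_intros isH isU) (auto simp: EH_def EV_def)
    moreover have "isCont f z"
      using contf V z by (metis continuous_on_eq_continuous_at subsetD)
    ultimately have cont: "isCont (\<lambda>z. 2 * pi * \<i> * f z - G z) z" by (intro continuous_intros)
    define m n where "m = \<lfloor>Re z / d\<rfloor>" and "n = \<lfloor>Im z / d\<rfloor>"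
    let ?B = "box (c m n) (c (m+1) (n+1))"
    have fl: "d * \<lfloor>t / d\<rfloor> \<le> t" "t \<le> d * (\<lfloor>t / d\<rfloor> + 1)" for t
    proof -
      define j where "j = \<lfloor>t / d\<rfloor>"
      have "real_of_int j \<le> t / d" "t / d \<le> real_of_int j + 1" unfolding j_def by linarith+
      then show "d * \<lfloor>t / d\<rfloor> \<le> t" "t \<le> d * (\<lfloor>t / d\<rfloor> + 1)"
        using d(1) by (simp_all add: field_simps flip: j_def)
    qed
    have zsq: "z \<in> sq (m, n)" using fl[of "Re z"] fl[of "Im z"] by (auto simp: mem_sq m_def n_def)
    then have mn: "(m, n) \<in> S" using z by (auto simp: S_def)
    have "c m n + Complex (d/2) (d/2) \<in> ?B" using d by (auto simp: in_box_complex_iff c_def algebra_simps)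
    then have clB: "closure ?B = sq (m, n)" by (subst closure_box) (auto simp: sq_def)
    show ?thesis
    proof (cases "z \<in> ?B")
      case False
      then have "z islimpt ?B" using zsq clB by (auto simp: closure_def)
      then have nt: "at z within ?B \<noteq> bot" by (simp add: trivial_limit_within)
      have "((\<lambda>z. 2 * pi * \<i> * f z - G z) \<longlongrightarrow> 2 * pi * \<i> * f z - G z) (at z within ?B)"
        using cont unfolding isCont_def by (rule tendsto_within_subset) simp
      moreover have "((\<lambda>z. 2 * pi * \<i> * f z - G z) \<longlongrightarrow> 0) (at z within ?B)"
        by (rule Lim_transform_eventually[OF tendsto_const])
          (use on_box mn in \<open>auto simp: eventually_at_filter\<close>)
      ultimately show ?thesis using tendsto_unique[OF nt] by fastforce
    qed (use on_box mn in blast)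
  qed
  then have "f z = (1 / (2 * pi * \<i>)) * G z" if "z \<in> K" for z using that by (simp add: field_simps)
  moreover have "(\<lambda>z. (1 / (2 * pi * \<i>)) * G z) \<in> poly_approx K"
    by (intro poly_approx_mult[OF K const_in_poly_approx] G)
  ultimately show ?thesis by (auto simp: poly_approx_def)
qed

text \<open>The set \<open>- outside K\<close> is \<open>K\<close> with its holes filled.\<close>

lemma outside_thickening:
  fixes K V :: "complex set"
  assumes K: "compact K" and V: "open V" "- outside K \<subseteq> V"
  obtains r where "r > 0" "- outside (\<Union>x\<in>K. cball x r) \<subseteq> V"
proof -
  define L where "L n = (\<Union>x\<in>K. cball x (1 / real (Suc n)))" for n
  have cL: "compact (L n)" for n unfolding L_def by (rule compact_minkowski_sum_cball[OF K])
  have anti: "L n \<subseteq> L m" if "m \<le> n" for m n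
  proof -
    have "1 / real (Suc n) \<le> 1 / real (Suc m)" using that by (simp add: frac_le)
    then show ?thesis unfolding L_def by (intro UN_mono subset_cball) auto
  qed
  \<comment> \<open>A point outside \<open>K\<close> is joined to a far point by a path in
    \<open>- K\<close>. The path has positive distance from \<open>K\<close>, so it avoids a thin
    enough thickening.\<close>
  have "outside K \<subseteq> (\<Union>n. outside (L n))"
  proof
    fix x assume "x \<in> outside K"
    then have unb: "\<not> bounded (connected_component_set (- K) x)" by (simp add: outside)
    obtain B where B: "L 0 \<subseteq> ball 0 B"
      using bounded_subset_ballD[OF compact_imp_bounded[OF cL], of 0 0] by blast
    obtain y where y: "connected_component (- K) x y" "y \<notin> ball 0 B"
      using unb bounded_subset[OF bounded_ball[of 0 B]] by blast
    have "open (- K)" using K by (simp add: compact_imp_closed open_Compl)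
    then obtain g where g: "path g" "path_image g \<subseteq> - K" "pathstart g = x" "pathfinish g = y"
      using y(1) by (metis open_path_connected_component path_component_def)
    obtain d where d: "d > 0" "\<And>a b. a \<in> path_image g \<Longrightarrow> b \<in> K \<Longrightarrow> d \<le> dist a b"
      using separate_compact_closed[OF compact_path_image[OF g(1)] compact_imp_closed[OF K]] g(2) by blast
    obtain n where n: "1 / real (Suc n) < d" using d(1) nat_approx_posE by blast
    have "path_image g \<subseteq> - L n"
      using d(2) n by (fastforce simp: L_def dist_commute)
    then have "connected_component (- L n) y x"
      unfolding connected_component_def
      using connected_path_image[OF g(1)] g(3,4) pathstart_in_path_image pathfinish_in_path_image by blast
    moreover have "y \<in> outside (L n)"
      using outside_subset_convex[OF convex_ball, of "L n" 0 B] anti[of 0 n] B y(2) by blast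
    ultimately show "x \<in> (\<Union>n. outside (L n))" using outside_same_component by blast
  qed
  moreover have "- outside (L 0) - V \<subseteq> outside K" using V(2) by blast
  ultimately have cover: "- outside (L 0) - V \<subseteq> (\<Union>n\<in>UNIV. outside (L n))" by blast
  have op: "open (outside (L n))" for n by (intro open_outside compact_imp_closed cL)
  \<comment> \<open>The part of the largest filled thickening that leaves \<open>V\<close> is
    compact and covered by the increasing open sets \<open>outside (L n)\<close>, so a single n
    takes care of it.\<close>
  have "compact (- outside (L 0) - V)"
    using V(1) op[of 0] cobounded_outside[OF compact_imp_bounded[OF cL]]
    by (auto simp: compact_eq_bounded_closed intro: bounded_diff closed_Diff)
  then obtain C where C: "finite C" "- outside (L 0) - V \<subseteq> (\<Union>n\<in>C. outside (L n))"
    using compactE_image[OF _ _ cover] op by metis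
  define N where "N = Max (insert 0 C)"
  have "outside (L n) \<subseteq> outside (L N)" if "n \<in> insert 0 C" for n
    using that C(1) by (intro outside_mono anti) (auto simp: N_def)
  then have "- outside (L N) \<subseteq> V" using C(2) by blast
  then show ?thesis using that[of "1 / real (Suc N)"] unfolding L_def by simp
qed

text \<open>Cauchy's inequality, with a threshold \<eta> depending on r, \<epsilon> and N alone, so
  that one choice serves all functions and all centres.\<close>

lemma higher_deriv_small:
  assumes "r > 0" "\<epsilon> > 0"
  shows "\<exists>\<eta>>0. \<forall>f z l. f holomorphic_on ball z r \<and> continuous_on (cball z r) f \<and>
    (\<forall>w\<in>cball z r. cmod (f w) \<le> \<eta>) \<and> l \<le> N \<longrightarrow> cmod ((deriv ^^ l) f z) < \<epsilon>"
proof -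
  define M where "M = (\<Sum>l\<le>N. fact l / r ^ l)"
  have M: "fact l / r ^ l \<le> M" if "l \<le> N" for l
    unfolding M_def using that assms(1) by (intro member_le_sum) auto
  have "M > 0" using M[of 0] by simp
  show ?thesis
  proof (intro exI[of _ "\<epsilon> / (2 * M)"] conjI allI impI; (elim conjE)?)
    show "\<epsilon> / (2 * M) > 0" using assms \<open>M > 0\<close> by simp
    fix f z l assume f: "f holomorphic_on ball z r" "continuous_on (cball z r) f"
      "\<forall>w\<in>cball z r. cmod (f w) \<le> \<epsilon> / (2 * M)" and l: "l \<le> N"
    have "cmod ((deriv ^^ l) f z) \<le> fact l * (\<epsilon> / (2 * M)) / r ^ l"
      using f assms by (intro Cauchy_inequality) (auto simp: dist_norm)
    also have "\<dots> = (fact l / r ^ l) * (\<epsilon> / (2 * M))" by simp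
    also have "\<dots> \<le> M * (\<epsilon> / (2 * M))"
      using M[OF l] assms \<open>M > 0\<close> by (intro mult_right_mono) auto
    also have "\<dots> < \<epsilon>" using assms \<open>M > 0\<close> by simp
    finally show "cmod ((deriv ^^ l) f z) < \<epsilon>" .
  qed
qed

text \<open>Runge's theorem is applied on a filled thickening of \<open>K\<close>: filling makes the
  complement connected, and thickening leaves room for discs of radius r about the points of
  \<open>K\<close>, on which Cauchy's inequality turns uniform closeness into closeness of
  derivatives.\<close>

lemma polynomial_higher_deriv_approx:
  assumes K: "compact K" and V: "open V" "- outside K \<subseteq> V" and h: "h holomorphic_on V" and "\<epsilon> > 0"
  shows "\<exists>p. \<forall>l\<le>N. \<forall>z\<in>K. cmod ((deriv ^^ l) h z - (deriv ^^ l) (poly p) z) < \<epsilon>"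
proof -
  obtain r where r: "r > 0" "- outside (\<Union>x\<in>K. cball x r) \<subseteq> V"
    using outside_thickening[OF K V] by blast
  let ?L = "- outside (\<Union>x\<in>K. cball x r)"
  have cT: "compact (\<Union>x\<in>K. cball x r)" by (rule compact_minkowski_sum_cball[OF K])
  have cL: "compact ?L"
    using cobounded_outside[OF compact_imp_bounded[OF cT]] open_outside[OF compact_imp_closed[OF cT]]
    by (simp add: compact_eq_bounded_closed closed_Compl)
  have "connected (- ?L)" using connected_outside[OF compact_imp_bounded[OF cT]] by simp
  then have app: "h \<in> poly_approx ?L" by (rule Runge_polynomial[OF cL _ V(1) r(2) h])
  obtain \<eta> where \<eta>: "\<eta> > 0" "\<forall>f z l. f holomorphic_on ball z r \<and> continuous_on (cball z r) f \<and>
    (\<forall>w\<in>cball z r. cmod (f w) \<le> \<eta>) \<and> l \<le> N \<longrightarrow> cmod ((deriv ^^ l) f z) < \<epsilon>"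
    using higher_deriv_small[OF r(1) \<open>\<epsilon> > 0\<close>, of N] by blast
  obtain p where p: "\<forall>z\<in>?L. cmod (h z - poly p z) < \<eta>"
    using poly_approxD[OF app \<eta>(1)] by blast
  show ?thesis
  proof (intro exI[of _ p] allI impI ballI)
    fix l z assume l: "l \<le> N" and z: "z \<in> K"
    have L: "cball z r \<subseteq> ?L" using z outside_no_overlap[of "\<Union>x\<in>K. cball x r"] by blast
    then have cV: "cball z r \<subseteq> V" using r(2) by (rule subset_trans)
    have pV: "poly p holomorphic_on V" by (intro holomorphic_intros)
    have hol: "(\<lambda>w. h w - poly p w) holomorphic_on V" using h pV by (intro holomorphic_intros)
    have "cmod ((deriv ^^ l) (\<lambda>w. h w - poly p w) z) < \<epsilon>"
    proof (intro \<eta>(2)[rule_format] conjI l)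
      show "(\<lambda>w. h w - poly p w) holomorphic_on ball z r"
        using cV by (intro holomorphic_on_subset[OF hol]) auto
      show "continuous_on (cball z r) (\<lambda>w. h w - poly p w)"
        using cV by (rule continuous_on_subset[OF holomorphic_on_imp_continuous_on[OF hol]])
      show "\<forall>w\<in>cball z r. cmod (h w - poly p w) \<le> \<eta>" using p L by (meson less_imp_le subsetD)
    qed
    moreover have "z \<in> V" using cV r(1) by auto
    ultimately show "cmod ((deriv ^^ l) h z - (deriv ^^ l) (poly p) z) < \<epsilon>"
      using higher_deriv_diff[OF h pV V(1)] by simp
  qed
qed

text \<open>A point of a hole of \<open>K\<close> that is not in \<open>C\<close> would be cut off
  from infinity: the inside of \<open>K\<close>, and the outside together with infinity, are
  disjoint open sets that cover the complement of \<open>C\<close> and both meet it.\<close>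

lemma connected_complement_imp_outside:
  assumes conn: "connectedin riemann_sphere (topspace riemann_sphere - Some ` C)"
    and K: "compact K" "K \<subseteq> C"
  shows "- outside K \<subseteq> C"
proof (rule ccontr)
  assume "\<not> - outside K \<subseteq> C"
  then obtain x where x: "x \<notin> outside K" "x \<notin> C" by blast
  have cl: "closed K" using K by (simp add: compact_imp_closed)
  have opi: "open (inside K)" by (rule open_inside[OF cl])
  have cK: "compact (- outside K)"
    using cobounded_outside[OF compact_imp_bounded[OF K(1)]] open_outside[OF cl]
    by (simp add: compact_eq_bounded_closed closed_Compl)
  \<comment> \<open>\<open>UNIV - - outside K\<close> is written as the complement of a compact set
    to match the neighbourhoods of infinity in
    \<open>openin_Alexandroff_compactification\<close>.\<close>
  let ?E1 = "Some ` inside K" and ?E2 = "insert None (Some ` (UNIV - - outside K))"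
  show False
  proof (rule connectedinD[OF conn])
    show "openin riemann_sphere ?E1" using opi by (simp add: riemann_sphere_def)
    show "openin riemann_sphere ?E2"
      unfolding riemann_sphere_def openin_Alexandroff_compactification
      using cK by (intro disjI2 exI[of _ "- outside K"]) (simp add: compact_imp_closed)
    show "topspace riemann_sphere - Some ` C \<subseteq> ?E1 \<union> ?E2"
      using K(2) by (auto simp: riemann_sphere_def inside_outside)
    show "?E1 \<inter> ?E2 \<inter> (topspace riemann_sphere - Some ` C) = {}"
      by (auto simp: inside_outside)
    show "?E1 \<inter> (topspace riemann_sphere - Some ` C) \<noteq> {}"
      using x K(2) by (auto simp: riemann_sphere_def inside_outside)
    show "?E2 \<inter> (topspace riemann_sphere - Some ` C) \<noteq> {}"
      by (auto simp: riemann_sphere_def)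
  qed
qed

section \<open>Completeness and the Baire property\<close>

lemma
  assumes "open \<Omega>" "f \<in> A_inf \<Omega>"
  shows continuous_on_closure_deriv: "continuous_on (closure \<Omega>) (closure_deriv \<Omega> l f)"
    and closure_deriv_on: "z \<in> \<Omega> \<Longrightarrow> closure_deriv \<Omega> l f z = (deriv ^^ l) f z"
proof -
  obtain g where g: "continuous_on (closure \<Omega>) g" "\<And>z. z \<in> \<Omega> \<Longrightarrow> g z = (deriv ^^ l) f z"
    using assms(2) unfolding A_inf_def by blast
  have eq: "closure_deriv \<Omega> l f z = g z" if "z \<in> closure \<Omega>" for z
    by (rule closure_deriv_eq[OF assms(1) g that])
  then show "continuous_on (closure \<Omega>) (closure_deriv \<Omega> l f)"
    using g(1) by (simp cong: continuous_on_cong)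
  show "closure_deriv \<Omega> l f z = (deriv ^^ l) f z" if "z \<in> \<Omega>"
    using eq[of z] g(2)[OF that] that closure_subset by auto
qed

text \<open>Each sequence of derivatives has a limit \<open>g l\<close> continuous up to the
  boundary, and Weierstrass' theorem identifies it inside \<Omega> with the l-th derivative of
  \<open>g 0\<close>. Pointwise limits give one candidate for all compact sets at once.\<close>

lemma A_inf_complete:
  assumes O: "open \<Omega>" and F: "\<And>n. F n \<in> A_inf \<Omega>"
    and Cauchy: "\<And>l K. compact K \<Longrightarrow> K \<subseteq> closure \<Omega> \<Longrightarrow> uniformly_Cauchy_on K (\<lambda>n. closure_deriv \<Omega> l (F n))"
  shows "\<exists>f. limitin (A_inf_topology \<Omega>) F f sequentially"
proof -
  define g where "g l z = lim (\<lambda>n. closure_deriv \<Omega> l (F n) z)" for l z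
  have lim: "uniform_limit K (\<lambda>n. closure_deriv \<Omega> l (F n)) (g l) sequentially"
    if "compact K" "K \<subseteq> closure \<Omega>" for K l
    using Cauchy_uniformly_convergent[OF Cauchy[OF that, of l]]
    unfolding uniformly_convergent_uniform_limit_iff g_def .
  have gcont: "continuous_on (closure \<Omega>) (g l)" for l
    unfolding continuous_on_def
  proof
    fix z assume z: "z \<in> closure \<Omega>"
    \<comment> \<open>Uniform convergence is available on compact sets, continuity is local, and
      this compact set is a neighbourhood of z relative to the closure.\<close>
    let ?K = "closure \<Omega> \<inter> cball z 1"
    have "continuous_on ?K (g l)"
    proof (rule uniform_limit_theorem[OF _ lim])
      show "\<forall>\<^sub>F n in sequentially. continuous_on ?K (closure_deriv \<Omega> l (F n))"
        by (intro always_eventually allI continuous_on_subset[OF continuous_on_closure_deriv[OF O F]]) auto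
    qed (auto simp: closed_Int_compact)
    then have "(g l \<longlongrightarrow> g l z) (at z within ?K)" using z by (simp add: continuous_on_def)
    moreover have "at z within closure \<Omega> = at z within ?K"
      by (rule at_within_nhd[of z "ball z 1"]) auto
    ultimately show "(g l \<longlongrightarrow> g l z) (at z within closure \<Omega>)" by simp
  qed
  have limF: "uniform_limit S F (g 0) sequentially" if "S \<subseteq> K" "compact K" "K \<subseteq> \<Omega>" for S K
  proof -
    have "uniform_limit S (\<lambda>n. closure_deriv \<Omega> 0 (F n)) (g 0) sequentially"
      using that closure_subset[of \<Omega>] by (intro uniform_limit_on_subset[OF lim[of K]]) auto
    moreover have "closure_deriv \<Omega> 0 (F n) z = F n z" if "z \<in> S" for n z
      using closure_deriv_on[OF O F, of z 0 n] \<open>S \<subseteq> K\<close> \<open>K \<subseteq> \<Omega>\<close> that by auto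
    ultimately show ?thesis by (simp cong: uniform_limit_cong')
  qed
  have holF: "F n holomorphic_on \<Omega>" for n using F by (simp add: A_inf_def)
  have holg: "g 0 holomorphic_on \<Omega>"
  proof (rule holomorphic_uniform_sequence[OF O holF])
    fix z assume "z \<in> \<Omega>"
    then obtain d where d: "d > 0" "cball z d \<subseteq> \<Omega>" using O open_contains_cball by blast
    then show "\<exists>d>0. cball z d \<subseteq> \<Omega> \<and> uniform_limit (cball z d) F (g 0) sequentially"
      using limF[OF subset_refl compact_cball d(2)] by blast
  qed
  have gderiv: "g l z = (deriv ^^ l) (g 0) z" if z: "z \<in> \<Omega>" for l z
  proof -
    obtain d where d: "d > 0" "cball z d \<subseteq> \<Omega>" using O z open_contains_cball by blast
    have "(\<lambda>n. (deriv ^^ l) (F n) z) \<longlonglongrightarrow> (deriv ^^ l) (g 0) z"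
    proof (rule higher_deriv_complex_uniform_limit)
      show "uniform_limit (ball z d) F (g 0) sequentially"
        by (rule limF[OF ball_subset_cball compact_cball d(2)])
      show "\<forall>\<^sub>F n in sequentially. F n holomorphic_on ball z d"
        by (intro always_eventually allI holomorphic_on_subset[OF holF] subset_trans[OF ball_subset_cball d(2)])
    qed (use d in auto)
    moreover have "(\<lambda>n. (deriv ^^ l) (F n) z) \<longlonglongrightarrow> g l z"
    proof -
      have "{z} \<subseteq> closure \<Omega>" using z closure_subset by auto
      then have "(\<lambda>n. closure_deriv \<Omega> l (F n) z) \<longlonglongrightarrow> g l z"
        using lim[of "{z}" l] by (auto dest: tendsto_uniform_limitI)
      then show ?thesis by (simp add: closure_deriv_on[OF O F z])
    qed
    ultimately show ?thesis by (rule LIMSEQ_unique[symmetric])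
  qed
  define f where "f = restrict (g 0) \<Omega>"
  have fhol: "f holomorphic_on \<Omega>" by (rule holomorphic_transform[OF holg]) (simp add: f_def)
  have fderiv: "g l z = (deriv ^^ l) f z" if "z \<in> \<Omega>" for l z
  proof -
    have "(deriv ^^ l) f z = (deriv ^^ l) (g 0) z"
      by (rule higher_deriv_transform_within_open[OF fhol holg O that]) (simp add: f_def)
    then show ?thesis using gderiv[OF that] by simp
  qed
  have fA: "f \<in> A_inf \<Omega>"
    unfolding A_inf_def
  proof (intro CollectI conjI allI)
    show "f \<in> extensional \<Omega>" by (simp add: f_def)
    show "\<exists>h. continuous_on (closure \<Omega>) h \<and> (\<forall>z\<in>\<Omega>. h z = (deriv ^^ l) f z)" for l
      using gcont[of l] fderiv by (intro exI[of _ "g l"]) simp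
  qed (rule fhol)
  have cdf: "closure_deriv \<Omega> l f z = g l z" if "z \<in> closure \<Omega>" for l z
    by (rule closure_deriv_eq[OF O gcont fderiv that])
  have "uniform_limit K (\<lambda>n. closure_deriv \<Omega> l (F n)) (closure_deriv \<Omega> l f) sequentially"
    if "compact K" "K \<subseteq> closure \<Omega>" for K l
  proof -
    have "uniform_limit K (\<lambda>n. closure_deriv \<Omega> l (F n)) (closure_deriv \<Omega> l f) sequentially \<longleftrightarrow>
        uniform_limit K (\<lambda>n. closure_deriv \<Omega> l (F n)) (g l) sequentially"
      using that(2) cdf by (intro uniform_limit_cong') auto
    then show ?thesis using lim[OF that] by simp
  qed
  then show ?thesis
    unfolding limitin_A_inf_topology[OF O] using fA F
    by (intro exI[of _ f] conjI allI impI always_eventually) auto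
qed

text \<open>Taking these balls as compact sets, with n also bounding the order of the derivatives,
  gives neighbourhoods that refine every basic neighbourhood in
  \<open>A_inf_topology\<close>.\<close>

lemma compact_subset_closure_cball:
  fixes K :: "complex set"
  assumes "compact K" "K \<subseteq> closure \<Omega>"
  obtains m where "\<And>n. n \<ge> m \<Longrightarrow> K \<subseteq> closure \<Omega> \<inter> cball 0 (real n)"
proof -
  obtain R where R: "\<And>z. z \<in> K \<Longrightarrow> cmod z \<le> R"
    using compact_imp_bounded[OF assms(1)] by (auto simp: bounded_iff)
  obtain m where m: "R \<le> real m" using real_arch_simple by blast
  show ?thesis
  proof (rule that[of m])
    fix n assume "n \<ge> m"
    then have "real m \<le> real n" by simp
    then show "K \<subseteq> closure \<Omega> \<inter> cball 0 (real n)" using R m assms(2) by fastforce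
  qed
qed

text \<open>Baire's argument with nested basic neighbourhoods, run directly because the topology is
  not presented by a metric. Completeness supplies the limit of the centres, and closedness keeps it
  in \<open>S\<close>.\<close>

lemma A_inf_Baire:
  fixes \<Omega> :: "complex set"
  assumes O: "open \<Omega>" and S: "closedin (A_inf_topology \<Omega>) S"
  defines "X \<equiv> subtopology (A_inf_topology \<Omega>) S"
  assumes U: "\<And>n :: nat. openin X (U n)" and dense: "\<And>n. X closure_of U n = topspace X"
  shows "X closure_of (\<Inter>n. U n) = topspace X"
proof
  show "X closure_of (\<Inter>n. U n) \<subseteq> topspace X" by (rule closure_of_subset_topspace)
  show "topspace X \<subseteq> X closure_of (\<Inter>n. U n)"
  proof
    fix f\<^sub>0 assume f0: "f\<^sub>0 \<in> topspace X"
    have SA: "S \<subseteq> A_inf \<Omega>" using closedin_subset[OF S] by simp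
    have topX: "topspace X = S" using SA by (auto simp: X_def)
    define nb where "nb f m \<epsilon> = A_inf_nbhd \<Omega> f (closure \<Omega> \<inter> cball 0 (real m)) m \<epsilon>" for f m \<epsilon>
    \<comment> \<open>The doubled radius prepares for the limit of the centres, where a strict bound
      by \<epsilon> weakens to \<le>. The bounds by k and e are left free to enforce the Cauchy
      property.\<close>
    have openX: "\<exists>m\<ge>k. \<exists>\<epsilon>>0. \<epsilon> \<le> e \<and> nb f m (2 * \<epsilon>) \<inter> S \<subseteq> T"
      if T: "openin X T" "f \<in> T" and e: "e > 0" for T f k e
    proof -
      obtain W where W: "openin (A_inf_topology \<Omega>) W" "T = W \<inter> S"
        using T(1) by (auto simp: X_def openin_subtopology)
      then obtain K N \<delta> where K: "compact K" "K \<subseteq> closure \<Omega>" "\<delta> > 0" "A_inf_nbhd \<Omega> f K N \<delta> \<subseteq> W"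
        using T(2) unfolding openin_A_inf_topology by blast
      obtain m where m: "\<And>n. n \<ge> m \<Longrightarrow> K \<subseteq> closure \<Omega> \<inter> cball 0 (real n)"
        using compact_subset_closure_cball[OF K(1,2)] by blast
      have "nb f (max k (max m N)) (2 * min e (\<delta> / 2)) \<subseteq> A_inf_nbhd \<Omega> f K N \<delta>"
        unfolding nb_def by (intro A_inf_nbhd_mono m) auto
      then show ?thesis
        using K(3,4) W(2) e
        by (intro exI[of _ "max k (max m N)"] exI[of _ "min e (\<delta> / 2)"] conjI) auto
    qed
    have nb_open: "\<exists>W. openin X W \<and> f \<in> W \<and> W \<subseteq> nb f m \<epsilon>" if f: "f \<in> S" "\<epsilon> > 0" for f m \<epsilon>
    proof -
      have "\<exists>W. openin (A_inf_topology \<Omega>) W \<and> f \<in> W \<and> W \<subseteq> nb f m \<epsilon>"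
        unfolding nb_def using O f SA by (intro openin_A_inf_nbhd_interior) (auto simp: closed_Int_compact)
      then obtain W where "openin (A_inf_topology \<Omega>) W" "f \<in> W" "W \<subseteq> nb f m \<epsilon>" by blast
      then show ?thesis using f(1) unfolding X_def
        by (intro exI[of _ "W \<inter> S"]) (auto intro: openin_subtopology_Int)
    qed
    show "f\<^sub>0 \<in> X closure_of (\<Inter>n. U n)"
      unfolding in_closure_of
    proof (intro conjI f0 allI impI)
      fix T assume T: "f\<^sub>0 \<in> T \<and> openin X T"
      \<comment> \<open>A triple holds a centre, an index for both the compact set and the order of
        the derivatives, and a radius. The conditions n \<le> m and \<epsilon> \<le> (1/2)^n make
        the centres Cauchy for every derivative on every compact set.\<close>
      define P where "P n x = (case x of (f, m, \<epsilon>) \<Rightarrow>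
        f \<in> S \<and> \<epsilon> > 0 \<and> n \<le> m \<and> \<epsilon> \<le> (1/2) ^ n \<and> nb f m (2 * \<epsilon>) \<inter> S \<subseteq> T)"
        for n :: nat and x :: "(complex \<Rightarrow> complex) \<times> nat \<times> real"
      define Q where "Q n x y = (case x of (f, m, \<epsilon>) \<Rightarrow> case y of (f', m', \<epsilon>') \<Rightarrow>
        nb f' m' (2 * \<epsilon>') \<inter> S \<subseteq> nb f m \<epsilon> \<inter> U n)"
        for n :: nat and x y :: "(complex \<Rightarrow> complex) \<times> nat \<times> real"
      have "\<exists>x. P 0 x"
        using openX[of T f\<^sub>0 1 0] T f0 topX by (auto simp: P_def)
      moreover have "\<exists>y. P (Suc n) y \<and> Q n x y" if x: "P n x" for n x
      proof -
        obtain f m \<epsilon> where fx: "x = (f, m, \<epsilon>)" by (cases x)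
        have f: "f \<in> S" "\<epsilon> > 0" "nb f m (2 * \<epsilon>) \<inter> S \<subseteq> T" using x by (auto simp: P_def fx)
        obtain W where W: "openin X W" "f \<in> W" "W \<subseteq> nb f m \<epsilon>" using nb_open[OF f(1,2)] by blast
        have "f \<in> X closure_of U n" using dense f(1) topX by simp
        then obtain f' where f': "f' \<in> U n" "f' \<in> W" using W(1,2) unfolding in_closure_of by blast
        have "openin X (U n \<inter> W)" using U W(1) by (rule openin_Int)
        then obtain m' \<epsilon>' where m': "m' \<ge> Suc n" "\<epsilon>' > 0" "\<epsilon>' \<le> (1/2) ^ Suc n"
          "nb f' m' (2 * \<epsilon>') \<inter> S \<subseteq> U n \<inter> W"
          using openX[of "U n \<inter> W" f' "(1/2) ^ Suc n" "Suc n"] f' by auto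
        have "nb f m \<epsilon> \<subseteq> nb f m (2 * \<epsilon>)" unfolding nb_def using f(2) by (intro A_inf_nbhd_mono) auto
        moreover have "f' \<in> S" using f' U openin_subset topX by blast
        ultimately have "P (Suc n) (f', m', \<epsilon>') \<and> Q n x (f', m', \<epsilon>')"
          unfolding P_def Q_def fx prod.case using m' W(3) f(3) by blast
        then show ?thesis by blast
      qed
      ultimately obtain s where s: "\<And>n. P n (s n)" "\<And>n. Q n (s n) (s (Suc n))"
        using dependent_nat_choice[of P Q] by blast
      define F m \<epsilon> where "F n = fst (s n)" and "m n = fst (snd (s n))" and "\<epsilon> n = snd (snd (s n))" for n
      have seq: "F n \<in> S" "\<epsilon> n > 0" "n \<le> m n" "\<epsilon> n \<le> (1/2) ^ n" "nb (F n) (m n) (2 * \<epsilon> n) \<inter> S \<subseteq> T"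
        and step: "nb (F (Suc n)) (m (Suc n)) (2 * \<epsilon> (Suc n)) \<inter> S \<subseteq> nb (F n) (m n) (\<epsilon> n) \<inter> U n" for n
        using s(1)[of n] s(2)[of n] by (auto simp: P_def Q_def F_def m_def \<epsilon>_def split: prod.splits)
      have FA: "F n \<in> A_inf \<Omega>" for n using seq(1) SA by blast
      have "nb (F n) (m n) (\<epsilon> n) \<subseteq> nb (F n) (m n) (2 * \<epsilon> n)" for n
        unfolding nb_def using seq(2)[of n] by (intro A_inf_nbhd_mono) auto
      then have "nb (F (Suc n)) (m (Suc n)) (\<epsilon> (Suc n)) \<inter> S \<subseteq> nb (F n) (m n) (\<epsilon> n) \<inter> S" for n
        using step[of n] by blast
      then have anti: "nb (F j) (m j) (\<epsilon> j) \<inter> S \<subseteq> nb (F n) (m n) (\<epsilon> n) \<inter> S" if "n \<le> j" for n j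
        using that by (rule lift_Suc_antimono_le)
      have Fnb: "F j \<in> nb (F n) (m n) (\<epsilon> n)" if "n \<le> j" for n j
      proof -
        have "F j \<in> nb (F j) (m j) (\<epsilon> j)" using FA seq(2)[of j] by (auto simp: nb_def A_inf_nbhd_def)
        then show ?thesis using anti[OF that] seq(1)[of j] by blast
      qed
      have close: "cmod (closure_deriv \<Omega> l (F j) z - closure_deriv \<Omega> l (F n) z) < \<epsilon> n"
        if "n \<le> j" "l \<le> m n" "z \<in> closure \<Omega> \<inter> cball 0 (real (m n))" for n j l z
        using Fnb[OF that(1)] that(2,3) by (auto simp: nb_def A_inf_nbhd_def)
      have "uniformly_Cauchy_on K (\<lambda>n. closure_deriv \<Omega> l (F n))"
        if K: "compact K" "K \<subseteq> closure \<Omega>" for K l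
        unfolding uniformly_Cauchy_on_def
      proof (intro allI impI)
        fix e :: real assume "e > 0"
        then obtain k where k: "(1/2) ^ k < e / 2" using real_arch_pow_inv[of "e / 2" "1/2"] by auto
        obtain j where j: "\<And>n. n \<ge> j \<Longrightarrow> K \<subseteq> closure \<Omega> \<inter> cball 0 (real n)"
          using compact_subset_closure_cball[OF K] by blast
        define n where "n = max (max k l) j"
        have "(1/2 :: real) ^ n \<le> (1/2) ^ k" by (intro power_decreasing) (auto simp: n_def)
        then have en: "\<epsilon> n < e / 2" using seq(4)[of n] k by linarith
        have "n \<le> m n" by (rule seq(3))
        then have ln: "l \<le> m n" and Kn: "K \<subseteq> closure \<Omega> \<inter> cball 0 (real (m n))"
          using j[of "m n"] by (simp_all add: n_def)
        have "dist (closure_deriv \<Omega> l (F a) z) (closure_deriv \<Omega> l (F b) z) < e"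
          if "z \<in> K" "a \<ge> n" "b \<ge> n" for z a b
        proof -
          have "dist (closure_deriv \<Omega> l (F a) z) (closure_deriv \<Omega> l (F n) z) < e / 2"
            "dist (closure_deriv \<Omega> l (F b) z) (closure_deriv \<Omega> l (F n) z) < e / 2"
            using close[OF that(2) ln subsetD[OF Kn that(1)]] close[OF that(3) ln subsetD[OF Kn that(1)]] en
            unfolding dist_norm by linarith+
          then show ?thesis by (rule dist_triangle_half_l)
        qed
        then show "\<exists>M. \<forall>x\<in>K. \<forall>a\<ge>M. \<forall>b\<ge>M. dist (closure_deriv \<Omega> l (F a) x) (closure_deriv \<Omega> l (F b) x) < e"
          by (intro exI[of _ n] ballI allI impI)
      qed
      from A_inf_complete[OF O FA this] obtain f where f: "limitin (A_inf_topology \<Omega>) F f sequentially" ..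
      have fS: "f \<in> S"
        by (rule limitin_closedin[OF f S]) (use seq(1) in auto)
      have lim: "\<forall>l K. compact K \<and> K \<subseteq> closure \<Omega> \<longrightarrow>
          uniform_limit K (\<lambda>j. closure_deriv \<Omega> l (F j)) (closure_deriv \<Omega> l f) sequentially"
        using f unfolding limitin_A_inf_topology[OF O] by blast
      have fnb: "f \<in> nb (F n) (m n) (2 * \<epsilon> n)" for n
      proof -
        have "cmod (closure_deriv \<Omega> l f z - closure_deriv \<Omega> l (F n) z) < 2 * \<epsilon> n"
          if l: "l \<le> m n" and z: "z \<in> closure \<Omega> \<inter> cball 0 (real (m n))" for l z
        proof -
          have "uniform_limit {z} (\<lambda>j. closure_deriv \<Omega> l (F j)) (closure_deriv \<Omega> l f) sequentially"
            using z by (intro lim[rule_format]) auto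
          then have "(\<lambda>j. closure_deriv \<Omega> l (F j) z) \<longlonglongrightarrow> closure_deriv \<Omega> l f z"
            by (auto dest: tendsto_uniform_limitI)
          then have "(\<lambda>j. cmod (closure_deriv \<Omega> l (F j) z - closure_deriv \<Omega> l (F n) z))
              \<longlonglongrightarrow> cmod (closure_deriv \<Omega> l f z - closure_deriv \<Omega> l (F n) z)"
            by (intro tendsto_intros)
          moreover have "\<forall>\<^sub>F j in sequentially. cmod (closure_deriv \<Omega> l (F j) z - closure_deriv \<Omega> l (F n) z) \<le> \<epsilon> n"
            using eventually_ge_at_top[of n] by eventually_elim (rule less_imp_le[OF close[OF _ l z]])
          ultimately have "cmod (closure_deriv \<Omega> l f z - closure_deriv \<Omega> l (F n) z) \<le> \<epsilon> n"
            by (rule tendsto_upperbound) simp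
          then show ?thesis using seq(2)[of n] by linarith
        qed
        then show ?thesis using fS SA by (auto simp: nb_def A_inf_nbhd_def)
      qed
      have "f \<in> T" using fnb[of 0] seq(5)[of 0] fS by blast
      moreover have "f \<in> U n" for n using fnb[of "Suc n"] step[of n] fS by blast
      ultimately show "\<exists>y. y \<in> (\<Inter>n. U n) \<and> y \<in> T" by blast
    qed
  qed
qed

section \<open>Pade approximants near a polynomial\<close>

lemma det_mat_nonzero:
  fixes t :: "nat \<Rightarrow> nat \<Rightarrow> complex"
  assumes inj: "\<And>u. (\<And>i. i < q \<Longrightarrow> (\<Sum>j<q. t i j * u j) = 0) \<Longrightarrow> (\<And>j. j < q \<Longrightarrow> u j = 0)"
  shows "Determinant.det (Matrix.mat q q (\<lambda>(i, j). t i j)) \<noteq> 0"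
proof
  let ?A = "Matrix.mat q q (\<lambda>(i, j). t i j)"
  assume "Determinant.det ?A = 0"
  then obtain v where v: "v \<in> carrier_vec q" "v \<noteq> 0\<^sub>v q" "?A *\<^sub>v v = 0\<^sub>v q"
    using det_0_iff_vec_prod_zero_field[of ?A q] by auto
  have "(\<Sum>j<q. t i j * vec_index v j) = 0" if "i < q" for i
  proof -
    have "vec_index (?A *\<^sub>v v) i = (\<Sum>j<q. t i j * vec_index v j)"
      using v(1) that by (simp add: scalar_prod_def atLeast0LessThan)
    then show ?thesis using v(3) that by simp
  qed
  from inj[OF this] have "v = 0\<^sub>v q" using v(1) by auto
  then show False using v(2) by simp
qed

lemma mat_equation_solvable:
  fixes t :: "nat \<Rightarrow> nat \<Rightarrow> complex"
  assumes "Determinant.det (Matrix.mat q q (\<lambda>(i, j). t i j)) \<noteq> 0"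
  obtains u where "\<And>i. i < q \<Longrightarrow> (\<Sum>j<q. t i j * u j) = b i"
proof -
  let ?A = "Matrix.mat q q (\<lambda>(i, j). t i j)"
  have A: "?A \<in> carrier_mat q q" by simp
  obtain B where B: "B \<in> carrier_mat q q" "?A * B = 1\<^sub>m q"
    using det_non_zero_imp_unit[OF A assms, of "()"] by (auto simp: Units_def ring_mat_def)
  define v where "v = B *\<^sub>v Matrix.vec q b"
  have v: "v \<in> carrier_vec q" using B(1) by (simp add: v_def)
  have "?A *\<^sub>v v = Matrix.vec q b"
    unfolding v_def using assoc_mult_mat_vec[OF A B(1), of "Matrix.vec q b"] B(2) by simp
  then have "(\<Sum>j<q. t i j * vec_index v j) = b i" if "i < q" for i
  proof -
    have "vec_index (?A *\<^sub>v v) i = (\<Sum>j<q. t i j * vec_index v j)"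
      using v that by (simp add: scalar_prod_def atLeast0LessThan)
    then show ?thesis using \<open>?A *\<^sub>v v = Matrix.vec q b\<close> that by simp
  qed
  then show ?thesis by (rule that)
qed

text \<open>A discrete Gronwall inequality, resting on 1 + s * (1 + ... + (1+s)^(k-1)) =
  (1+s)^k.\<close>

lemma lower_triangular_bound:
  fixes x :: "nat \<Rightarrow> real"
  assumes rec: "\<And>k. k < q \<Longrightarrow> x k \<le> \<rho> + s * (\<Sum>j<k. x j)" and s: "s \<ge> 0" and k: "k < q"
  shows "x k \<le> \<rho> * (1 + s) ^ k"
  using k
proof (induction k rule: less_induct)
  case (less k)
  have geom: "1 + s * (\<Sum>j<k. (1 + s) ^ j) = (1 + s) ^ k" for k
    by (induction k) (auto simp: algebra_simps)
  have "x k \<le> \<rho> + s * (\<Sum>j<k. x j)" by (rule rec[OF less.prems])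
  also have "\<dots> \<le> \<rho> + s * (\<Sum>j<k. \<rho> * (1 + s) ^ j)"
    using less s by (intro add_left_mono mult_left_mono sum_mono) auto
  also have "\<dots> = \<rho> * (1 + s * (\<Sum>j<k. (1 + s) ^ j))"
    by (simp add: sum_distrib_left algebra_simps)
  finally show ?case by (simp add: geom)
qed

lemma sum_lessThan_split:
  fixes f :: "nat \<Rightarrow> 'a :: comm_monoid_add"
  assumes "k < q"
  shows "(\<Sum>j<q. f j) = (\<Sum>j<k. f j) + (f k + (\<Sum>j\<in>{k<..<q}. f j))"
proof -
  have "{..<q} = {..<k} \<union> insert k {k<..<q}" using assms by auto
  moreover have "{..<k} \<inter> insert k {k<..<q} = {}" by auto
  ultimately have "(\<Sum>j<q. f j) = (\<Sum>j<k. f j) + (\<Sum>j\<in>insert k {k<..<q}. f j)"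
    by (metis finite_greaterThanLessThan finite_insert finite_lessThan sum.union_disjoint)
  then show ?thesis by simp
qed

text \<open>Substitution along the antidiagonal bounds the unknowns; the small entries of index
  above p cost \<delta> times the sum of all |u j|, which is absorbed on the left. The constants do
  not depend on p or on the sequence. Taking \<rho> = 0 gives invertibility, a small \<rho> gives
  small solutions.\<close>

lemma hankel_perturbation_bound:
  fixes c :: complex and B :: real and q :: nat
  assumes c: "c \<noteq> 0" and B: "B \<ge> 0"
  shows "\<exists>C>0. \<exists>\<delta>\<^sub>0>0. \<forall>\<alpha> p u \<delta> \<rho>. \<delta> \<le> \<delta>\<^sub>0 \<and> cmod (\<alpha> (int p) - c) \<le> \<delta> \<and>
    (\<forall>i. int p < i \<and> i < int p + int q \<longrightarrow> cmod (\<alpha> i) \<le> \<delta>) \<and> (\<forall>i<int p. cmod (\<alpha> i) \<le> B) \<and>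
    (\<forall>i<q. cmod (\<Sum>j<q. \<alpha> (int p - int q + int i + int j + 1) * u j) \<le> \<rho>) \<longrightarrow>
    (\<forall>j<q. cmod (u j) \<le> C * \<rho>)"
proof -
  define s where "s = B / cmod c"
  define D where "D = (1 + s) ^ q / cmod c"
  have s: "s \<ge> 0" using B by (simp add: s_def)
  have D: "D > 0" using c s by (auto simp: D_def intro!: divide_pos_pos)
  show ?thesis
  proof (intro exI conjI allI impI; (elim conjE)?)
    \<comment> \<open>The summand 1 keeps the constant positive, and the threshold a genuine
      quotient, when q = 0.\<close>
    have pos: "2 * q * D + 1 > 0" using D by (intro add_nonneg_pos) auto
    then show "2 * q * D + 1 > 0" .
    then show "1 / (2 * q * D + 1) > 0" by simp
    fix \<alpha> p u \<delta> \<rho> j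
    assume \<delta>: "\<delta> \<le> 1 / (2 * q * D + 1)" and ap: "cmod (\<alpha> (int p) - c) \<le> \<delta>"
      and hi: "\<forall>i. int p < i \<and> i < int p + int q \<longrightarrow> cmod (\<alpha> i) \<le> \<delta>" and lo: "\<forall>i<int p. cmod (\<alpha> i) \<le> B"
      and eq: "\<forall>i<q. cmod (\<Sum>j<q. \<alpha> (int p - int q + int i + int j + 1) * u j) \<le> \<rho>"
      and j: "j < q"
    define M where "M = (\<Sum>j<q. cmod (u j))"
    have \<delta>0: "\<delta> \<ge> 0" using ap norm_ge_zero order_trans by blast
    have \<rho>0: "\<rho> \<ge> 0" using eq j norm_ge_zero order_trans by blast
    have M0: "M \<ge> 0" by (auto simp: M_def intro: sum_nonneg)
    \<comment> \<open>Row \<open>q - 1 - k\<close> expresses \<open>u k\<close> through \<open>u j\<close> with \<open>j < k\<close>, up to terms of size \<open>\<delta> * M\<close>.\<close>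
    have row: "cmod (u k) \<le> (\<rho> + \<delta> * M) / cmod c + s * (\<Sum>j<k. cmod (u j))" if k: "k < q" for k
    proof -
      note split = sum_lessThan_split[OF k]
      have "cmod (\<Sum>j<q. \<alpha> (int p - int k + int j) * u j) \<le> \<rho>"
      proof -
        have idx: "int p - int q + int (q - 1 - k) + int j + 1 = int p - int k + int j" for j
          using k by (simp add: of_nat_diff)
        have "q - 1 - k < q" using k by simp
        from eq[rule_format, OF this] show ?thesis unfolding idx .
      qed
      moreover have "c * u k = (\<Sum>j<q. \<alpha> (int p - int k + int j) * u j)
          - (\<Sum>j<k. \<alpha> (int p - int k + int j) * u j) - (\<alpha> (int p) - c) * u k
          - (\<Sum>j\<in>{k<..<q}. \<alpha> (int p - int k + int j) * u j)" (is "_ = ?s - ?x - ?y - ?z")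
        by (subst split) (simp add: left_diff_distrib)
      then have "cmod (c * u k) \<le> cmod ?s + cmod ?x + cmod ?y + cmod ?z"
        using norm_triangle_ineq4[of "?s - ?x - ?y" ?z] norm_triangle_ineq4[of "?s - ?x" ?y]
          norm_triangle_ineq4[of ?s ?x] by simp
      moreover have "cmod (\<Sum>j<k. \<alpha> (int p - int k + int j) * u j) \<le> B * (\<Sum>j<k. cmod (u j))"
        unfolding sum_distrib_left using lo
        by (intro sum_norm_le) (auto simp: norm_mult intro!: mult_right_mono)
      moreover have "cmod ((\<alpha> (int p) - c) * u k) \<le> \<delta> * cmod (u k)"
        using ap by (simp add: norm_mult mult_right_mono)
      moreover have "cmod (\<Sum>j\<in>{k<..<q}. \<alpha> (int p - int k + int j) * u j) \<le> \<delta> * (\<Sum>j\<in>{k<..<q}. cmod (u j))"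
        unfolding sum_distrib_left using k
        by (intro sum_norm_le) (auto simp: norm_mult intro!: mult_right_mono hi[rule_format])
      ultimately have "cmod (c * u k) \<le> \<rho> + B * (\<Sum>j<k. cmod (u j)) + \<delta> * cmod (u k) + \<delta> * (\<Sum>j\<in>{k<..<q}. cmod (u j))"
        by linarith
      also have "\<dots> \<le> \<rho> + B * (\<Sum>j<k. cmod (u j)) + \<delta> * M"
      proof -
        have "\<delta> * (cmod (u k) + (\<Sum>j\<in>{k<..<q}. cmod (u j))) \<le> \<delta> * M"
          unfolding M_def split using \<delta>0 by (intro mult_left_mono) (auto intro: sum_nonneg)
        then show ?thesis by (simp add: algebra_simps)
      qed
      finally have "cmod c * cmod (u k) \<le> \<rho> + B * (\<Sum>j<k. cmod (u j)) + \<delta> * M" by (simp add: norm_mult)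
      then have "cmod (u k) \<le> (\<rho> + B * (\<Sum>j<k. cmod (u j)) + \<delta> * M) / cmod c"
        using c by (simp add: field_simps)
      also have "\<dots> = (\<rho> + \<delta> * M) / cmod c + s * (\<Sum>j<k. cmod (u j))"
        by (simp add: s_def add_divide_distrib)
      finally show ?thesis .
    qed
    have each: "cmod (u k) \<le> (\<rho> + \<delta> * M) * D" if k: "k < q" for k
    proof -
      have "cmod (u k) \<le> (\<rho> + \<delta> * M) / cmod c * (1 + s) ^ k"
        by (rule lower_triangular_bound[OF row s k])
      also have "\<dots> \<le> (\<rho> + \<delta> * M) / cmod c * (1 + s) ^ q"
        using s k \<rho>0 \<delta>0 M0 by (intro mult_left_mono power_increasing) auto
      finally show ?thesis by (simp add: D_def)
    qed
    \<comment> \<open>The bound on \<delta> makes q * D * \<delta> * M at most M / 2, so that M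
      \<le> 2 * q * D * \<rho>.\<close>
    have "M \<le> q * ((\<rho> + \<delta> * M) * D)"
      unfolding M_def using sum_bounded_above[of "{..<q}" "\<lambda>j. cmod (u j)" "(\<rho> + \<delta> * M) * D"] each
      by (simp flip: M_def)
    moreover have "\<delta> * (2 * q * D) \<le> 1"
      using \<delta> \<delta>0 pos by (simp add: field_simps)
    then have "\<delta> * (2 * q * D) * M \<le> 1 * M" using M0 by (rule mult_right_mono)
    ultimately have "M \<le> (2 * q * D) * \<rho>" by (simp add: algebra_simps)
    moreover have "cmod (u j) \<le> M" unfolding M_def using j by (intro member_le_sum) auto
    ultimately show "cmod (u j) \<le> (2 * q * D + 1) * \<rho>" using \<rho>0 by (simp add: algebra_simps)
  qed
qed

text \<open>Since \<open>Q\<close> is a unit, this passes from the linear equations Q F = P, valid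
  up to some order, to the Taylor coefficients of P/Q up to the same order.\<close>

lemma fps_nth_mult_cancel:
  fixes Q H :: "complex fps"
  assumes Q: "fps_nth Q 0 \<noteq> 0" and QH: "\<And>k. k \<le> n \<Longrightarrow> fps_nth (Q * H) k = 0" and k: "k \<le> n"
  shows "fps_nth H k = 0"
proof -
  have "H = inverse Q * (Q * H)" using inverse_mult_eq_1[OF Q] by (simp flip: mult.assoc)
  then have "fps_nth H k = fps_nth (inverse Q * (Q * H)) k" by (rule arg_cong)
  also have "\<dots> = 0" unfolding fps_mult_nth[of "inverse Q"] using QH k by (intro sum.neutral) auto
  finally show ?thesis .
qed

text \<open>The Hankel system for the denominator has the coefficients of index above p on its
  right-hand side. These are at most \<delta>, so Q is close to 1 and P close to the polynomial on
  the disc of radius M. Stating this for bare coefficient sequences makes \<delta> independent of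
  the centre.\<close>

lemma pade_of_perturbed_polynomial:
  fixes c :: complex and B M \<epsilon> :: real and p q :: nat
  assumes c: "c \<noteq> 0" and B: "B \<ge> 0" and M: "M \<ge> 0" and \<epsilon>: "\<epsilon> > 0"
  shows "\<exists>\<delta>>0. \<forall>\<alpha> \<beta> :: int \<Rightarrow> complex.
    (\<forall>i<0. \<beta> i = 0) \<and> (\<forall>i. 0 \<le> i \<and> i \<le> int p + int q \<longrightarrow> cmod (\<beta> i - \<alpha> i) \<le> \<delta>) \<and>
    \<alpha> (int p) = c \<and> (\<forall>i>int p. \<alpha> i = 0) \<and> (\<forall>i. cmod (\<alpha> i) \<le> B) \<longrightarrow>
    Determinant.det (Matrix.mat q q (\<lambda>(i, j). \<beta> (int p - int q + int i + int j + 1))) \<noteq> 0 \<and>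
    (\<exists>P Q. degree P \<le> p \<and> degree Q \<le> q \<and> poly.coeff Q 0 = 1 \<and>
      (\<forall>k\<le>p+q. fps_nth (fps_of_poly Q * Abs_fps (\<lambda>v. \<beta> (int v))) k = poly.coeff P k) \<and>
      (\<forall>w. cmod w \<le> M \<longrightarrow> poly Q w \<noteq> 0 \<and>
         cmod (poly P w / poly Q w - (\<Sum>k\<le>p. \<alpha> (int k) * w ^ k)) \<le> \<epsilon>))"
proof -
  have B1: "B + 1 \<ge> 0" using B by simp
  obtain C \<delta>\<^sub>0 where C: "C > 0" "\<delta>\<^sub>0 > 0"
    "\<forall>\<alpha> p u \<delta> \<rho>. \<delta> \<le> \<delta>\<^sub>0 \<and> cmod (\<alpha> (int p) - c) \<le> \<delta> \<and>
    (\<forall>i. int p < i \<and> i < int p + int q \<longrightarrow> cmod (\<alpha> i) \<le> \<delta>) \<and> (\<forall>i<int p. cmod (\<alpha> i) \<le> B + 1) \<and>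
    (\<forall>i<q. cmod (\<Sum>j<q. \<alpha> (int p - int q + int i + int j + 1) * u j) \<le> \<rho>) \<longrightarrow>
    (\<forall>j<q. cmod (u j) \<le> C * \<rho>)"
    using hankel_perturbation_bound[OF c B1, of q] by blast
  \<comment> \<open>On the disc of radius M the numerator deviates by at most \<delta> * E1 and the
    denominator by at most \<delta> * E2, while the polynomial is bounded by G. The choice of
    \<delta> yields |Q| \<ge> 1/2 and \<delta> * (E1 + G * E2) \<le> \<epsilon> / 2; division by Q
    at most doubles the latter.\<close>
  define E1 where "E1 = (\<Sum>k\<le>p. (1 + q * C * (B + 1)) * M ^ k)"
  define E2 where "E2 = (\<Sum>m=1..q. C * M ^ m)"
  define G where "G = (\<Sum>k\<le>p. B * M ^ k)"
  have nonneg: "E1 \<ge> 0" "E2 \<ge> 0" "G \<ge> 0" "E1 + G * E2 \<ge> 0"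
    using B M C(1) by (auto simp: E1_def E2_def G_def intro!: sum_nonneg mult_nonneg_nonneg add_nonneg_nonneg)
  define \<delta> where "\<delta> = Min {1, \<delta>\<^sub>0, 1 / (2 * E2 + 1), \<epsilon> / (2 * (E1 + G * E2) + 1)}"
  have \<delta>: "\<delta> > 0" "\<delta> \<le> 1" "\<delta> \<le> \<delta>\<^sub>0" and \<delta>E: "\<delta> \<le> 1 / (2 * E2 + 1)" "\<delta> \<le> \<epsilon> / (2 * (E1 + G * E2) + 1)"
    using C(2) nonneg \<epsilon> by (auto simp del: distrib_left_numeral simp: \<delta>_def intro!: divide_pos_pos add_nonneg_pos)
  have \<delta>E2: "\<delta> * E2 \<le> 1/2" using \<delta>E(1) nonneg \<delta>(1) by (simp add: field_simps)
  have \<delta>E1: "2 * (\<delta> * (E1 + G * E2)) \<le> \<epsilon>"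
  proof -
    have "\<delta> * (2 * (E1 + G * E2) + 1) \<le> \<epsilon>" using \<delta>E(2) nonneg by (simp add: pos_le_divide_eq)
    then show ?thesis using \<delta>(1) by (simp add: algebra_simps)
  qed
  show ?thesis
  proof (intro exI[of _ \<delta>] conjI allI impI \<delta>(1); elim conjE)
    fix \<alpha> \<beta> :: "int \<Rightarrow> complex"
    assume neg: "\<forall>i<0. \<beta> i = 0"
      and close: "\<forall>i. 0 \<le> i \<and> i \<le> int p + int q \<longrightarrow> cmod (\<beta> i - \<alpha> i) \<le> \<delta>"
      and ap: "\<alpha> (int p) = c" and hi: "\<forall>i>int p. \<alpha> i = 0" and bd: "\<forall>i. cmod (\<alpha> i) \<le> B"
    have bp: "cmod (\<beta> (int p) - c) \<le> \<delta>" using close[rule_format, of "int p"] ap by simp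
    have bhi: "cmod (\<beta> i) \<le> \<delta>" if "int p < i" "i \<le> int p + int q" for i
      using close[rule_format, of i] hi[rule_format, of i] that by simp
    have blo: "cmod (\<beta> i) \<le> B + 1" if "i \<le> int p + int q" for i
    proof (cases "i < 0")
      case False
      then show ?thesis using close[rule_format, of i] that bd[rule_format, of i] \<delta>(2) norm_triangle_sub[of "\<beta> i" "\<alpha> i"] by linarith
    qed (use neg B in simp)
    have bound: "cmod (u j) \<le> C * \<rho>"
      if "\<And>i. i < q \<Longrightarrow> cmod (\<Sum>j<q. \<beta> (int p - int q + int i + int j + 1) * u j) \<le> \<rho>" "j < q" for u \<rho> j
    proof -
      have "\<delta> \<le> \<delta>\<^sub>0 \<and> cmod (\<beta> (int p) - c) \<le> \<delta> \<and>
        (\<forall>i. int p < i \<and> i < int p + int q \<longrightarrow> cmod (\<beta> i) \<le> \<delta>) \<and> (\<forall>i<int p. cmod (\<beta> i) \<le> B + 1) \<and>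
        (\<forall>i<q. cmod (\<Sum>j<q. \<beta> (int p - int q + int i + int j + 1) * u j) \<le> \<rho>)"
        using \<delta>(3) bp bhi blo that(1) by auto
      from C(3)[rule_format, OF this that(2)] show ?thesis .
    qed
    have "u j = 0" if "\<And>i. i < q \<Longrightarrow> (\<Sum>j<q. \<beta> (int p - int q + int i + int j + 1) * u j) = 0" "j < q" for u j
      using bound[of u 0 j] that by simp
    then show det: "Determinant.det (Matrix.mat q q (\<lambda>(i, j). \<beta> (int p - int q + int i + int j + 1))) \<noteq> 0"
      by (rule det_mat_nonzero)
    obtain u where u: "\<And>i. i < q \<Longrightarrow>
        (\<Sum>j<q. \<beta> (int p - int q + int i + int j + 1) * u j) = - \<beta> (int p + 1 + int i)"
      using mat_equation_solvable[OF det, of "\<lambda>i. - \<beta> (int p + 1 + int i)"] by blast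
    \<comment> \<open>The right-hand side uses the indices p + 1, ..., p + q only, where \<alpha>
      vanishes and \<beta> is at most \<delta>.\<close>
    have usmall: "cmod (u j) \<le> C * \<delta>" if "j < q" for j
      using that by (intro bound) (auto simp: u intro: bhi)
    \<comment> \<open>The unknown \<open>u j\<close> of the Hankel system is the denominator coefficient of index \<open>q - j\<close>.\<close>
    define Q where "Q = 1 + (\<Sum>m=1..q. Polynomial.monom (u (q - m)) m)"
    define F where "F = Abs_fps (\<lambda>v. \<beta> (int v))"
    \<comment> \<open>The numerator is Q F cut off after degree p; the Hankel equations say that the
      next q coefficients of Q F vanish.\<close>
    define P where "P = truncate_fps (Suc p) (fps_of_poly Q * F)"
    have cQ: "poly.coeff Q m = (if m = 0 then 1 else if m \<le> q then u (q - m) else 0)" for m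
      by (auto simp: Q_def coeff_sum)
    have dQ: "degree Q \<le> q" by (rule degree_le) (auto simp: cQ)
    have dP: "degree P \<le> p" unfolding P_def using degree_truncate_fps[of "Suc p"] by (simp add: less_Suc_eq_le)
    have QF: "fps_nth (fps_of_poly Q * F) k = \<beta> (int k) + (\<Sum>m=1..q. u (q - m) * \<beta> (int k - int m))" for k
    proof -
      have "fps_nth (fps_of_poly Q * F) k = (\<Sum>m\<le>k. poly.coeff Q m * \<beta> (int k - int m))"
        by (simp add: fps_mult_nth F_def atLeast0AtMost of_nat_diff)
      also have "\<dots> = (\<Sum>m\<le>k + q. poly.coeff Q m * \<beta> (int k - int m))"
        using neg by (intro sum.mono_neutral_left) auto
      also have "\<dots> = (\<Sum>m\<in>insert 0 {1..q}. poly.coeff Q m * \<beta> (int k - int m))"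
        using cQ by (intro sum.mono_neutral_right) auto
      also have "\<dots> = \<beta> (int k) + (\<Sum>m=1..q. u (q - m) * \<beta> (int k - int m))"
        by (simp add: cQ)
      finally show ?thesis .
    qed
    have QF0: "fps_nth (fps_of_poly Q * F) k = 0" if k: "p < k" "k \<le> p + q" for k
    proof -
      define i where "i = k - p - 1"
      have i: "i < q" "int k = int p + 1 + int i" using k by (auto simp: i_def)
      \<comment> \<open>With j = q - m this is row \<open>i\<close> of the Hankel system, whose
        value cancels \<beta> (p + 1 + i).\<close>
      have "(\<Sum>m=1..q. u (q - m) * \<beta> (int k - int m)) =
          (\<Sum>j<q. \<beta> (int p - int q + int i + int j + 1) * u j)"
        by (rule sum.reindex_bij_witness[of _ "\<lambda>j. q - j" "\<lambda>m. q - m"])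
          (auto simp: i of_nat_diff algebra_simps)
      then show ?thesis using u[OF i(1)] by (simp add: QF i(2))
    qed
    have QP: "\<forall>k\<le>p+q. fps_nth (fps_of_poly Q * F) k = poly.coeff P k"
      using QF0 by (auto simp: P_def coeff_truncate_fps)
    have cP: "cmod (poly.coeff P k - \<alpha> (int k)) \<le> \<delta> * (1 + q * C * (B + 1))" if k: "k \<le> p" for k
    proof -
      have "poly.coeff P k - \<alpha> (int k) = (\<beta> (int k) - \<alpha> (int k)) + (\<Sum>m=1..q. u (q - m) * \<beta> (int k - int m))"
        using k QF[of k] by (simp add: P_def coeff_truncate_fps)
      also have "cmod \<dots> \<le> \<delta> + (\<Sum>m=1..q. (C * \<delta>) * (B + 1))"
      proof (intro norm_triangle_le add_mono sum_norm_le)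
        show "cmod (\<beta> (int k) - \<alpha> (int k)) \<le> \<delta>" using k by (intro close[rule_format]) auto
        fix m assume "m \<in> {1..q}"
        then show "cmod (u (q - m) * \<beta> (int k - int m)) \<le> (C * \<delta>) * (B + 1)"
          unfolding norm_mult using C(1) \<delta>(1) k by (intro mult_mono usmall blo) auto
      qed
      also have "\<dots> = \<delta> * (1 + q * C * (B + 1))" by (simp add: algebra_simps)
      finally show ?thesis .
    qed
    have "poly Q w \<noteq> 0 \<and> cmod (poly P w / poly Q w - (\<Sum>k\<le>p. \<alpha> (int k) * w ^ k)) \<le> \<epsilon>" if w: "cmod w \<le> M" for w
    proof -
      let ?g = "\<Sum>k\<le>p. \<alpha> (int k) * w ^ k"
      have "poly Q w - 1 = (\<Sum>m=1..q. u (q - m) * w ^ m)" by (simp add: Q_def poly_sum poly_monom)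
      also have "cmod \<dots> \<le> (\<Sum>m=1..q. (C * \<delta>) * M ^ m)"
        using w C(1) \<delta>(1) by (intro sum_norm_le)
          (auto simp: norm_mult norm_power intro!: mult_mono usmall power_mono)
      also have "\<dots> = \<delta> * E2" by (simp add: E2_def sum_distrib_left algebra_simps)
      finally have Q1: "cmod (poly Q w - 1) \<le> \<delta> * E2" .
      then have Qhalf: "cmod (poly Q w) \<ge> 1/2"
        using \<delta>E2 norm_triangle_ineq2[of 1 "1 - poly Q w"] by (simp add: norm_minus_commute)
      have "poly P w = (\<Sum>k\<le>p. poly.coeff P k * w ^ k)"
        using dP unfolding poly_altdef by (intro sum.mono_neutral_left) (auto simp: coeff_eq_0)
      then have "poly P w - ?g = (\<Sum>k\<le>p. (poly.coeff P k - \<alpha> (int k)) * w ^ k)"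
        by (simp add: sum_subtractf algebra_simps)
      also have "cmod \<dots> \<le> (\<Sum>k\<le>p. (\<delta> * (1 + q * C * (B + 1))) * M ^ k)"
        using w C(1) \<delta>(1) B by (intro sum_norm_le)
          (auto simp: norm_mult norm_power intro!: mult_mono cP power_mono)
      also have "\<dots> = \<delta> * E1" by (simp add: E1_def sum_distrib_left algebra_simps)
      finally have P1: "cmod (poly P w - ?g) \<le> \<delta> * E1" .
      have g1: "cmod ?g \<le> G"
        unfolding G_def using w B M by (intro sum_norm_le)
          (auto simp: norm_mult norm_power intro!: mult_mono bd[rule_format] power_mono)
      have "cmod (poly P w - ?g * poly Q w) \<le> cmod (poly P w - ?g) + cmod ?g * cmod (poly Q w - 1)"
      proof -
        have "poly P w - ?g * poly Q w = (poly P w - ?g) - ?g * (poly Q w - 1)"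
          by (simp add: algebra_simps)
        then show ?thesis
          using norm_triangle_ineq4[of "poly P w - ?g" "?g * (poly Q w - 1)"] by (simp only: norm_mult)
      qed
      also have "\<dots> \<le> \<delta> * E1 + G * (\<delta> * E2)"
        using P1 g1 Q1 nonneg by (intro add_mono mult_mono) auto
      finally have PQ: "cmod (poly P w - ?g * poly Q w) \<le> \<delta> * (E1 + G * E2)" by (simp add: algebra_simps)
      have Q0: "poly Q w \<noteq> 0" using Qhalf by auto
      then have "poly P w / poly Q w - ?g = (poly P w - ?g * poly Q w) / poly Q w"
        by (simp add: diff_divide_distrib)
      then have "cmod (poly P w / poly Q w - ?g) = cmod (poly P w - ?g * poly Q w) / cmod (poly Q w)"
        by (simp only: norm_divide)
      also have "\<dots> \<le> (\<delta> * (E1 + G * E2)) / (1/2)"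
        using PQ Qhalf nonneg \<delta>(1) by (intro frac_le) auto
      also have "\<dots> \<le> \<epsilon>" using \<delta>E1 by simp
      finally show ?thesis using Q0 by blast
    qed
    then show "\<exists>P Q. degree P \<le> p \<and> degree Q \<le> q \<and> poly.coeff Q 0 = 1 \<and>
      (\<forall>k\<le>p+q. fps_nth (fps_of_poly Q * Abs_fps (\<lambda>v. \<beta> (int v))) k = poly.coeff P k) \<and>
      (\<forall>w. cmod w \<le> M \<longrightarrow> poly Q w \<noteq> 0 \<and>
         cmod (poly P w / poly Q w - (\<Sum>k\<le>p. \<alpha> (int k) * w ^ k)) \<le> \<epsilon>)"
      using dP dQ QP cQ[of 0] unfolding F_def by (intro exI[of _ P] exI[of _ Q]) auto
  qed
qed

section \<open>Rational functions, their formal expansions, and uniqueness of Pade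
  approximants\<close>

lemma has_fps_expansion_poly: "poly (p :: complex poly) has_fps_expansion fps_of_poly p"
proof (induction p)
  case (pCons a p)
  have "(\<lambda>x. a + x * poly p x) has_fps_expansion (fps_const a + fps_X * fps_of_poly p)"
    by (intro fps_expansion_intros pCons.IH)
  moreover have "(\<lambda>x. a + x * poly p x) = poly (pCons a p)" by auto
  moreover have "fps_const a + fps_X * fps_of_poly p = fps_of_poly (pCons a p)"
    by (simp add: fps_of_poly_pCons mult.commute)
  ultimately show ?case by simp
qed simp

lemma higher_deriv_poly: "(deriv ^^ l) (poly p) = poly ((pderiv ^^ l) p)" for p :: "complex poly"
proof (induction l)
  case (Suc l)
  have "deriv (poly r) = poly (pderiv r)" for r :: "complex poly"
    by (intro ext DERIV_imp_deriv poly_DERIV)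
  then show ?case using Suc by simp
qed simp

text \<open>The denominator does not vanish at the centre, so the fraction is analytic there and
  \<open>remove_sings\<close> changes nothing nearby; the expansion is the formal quotient.\<close>

lemma fps_expansion_rational:
  assumes "poly.coeff Q 0 \<noteq> 0"
  shows "fps_expansion (remove_sings (\<lambda>z. poly P (z - \<zeta>) / poly Q (z - \<zeta>))) \<zeta> = fps_of_poly P / fps_of_poly Q"
proof -
  have Q0: "poly Q 0 \<noteq> 0" using assms by (simp add: poly_0_coeff_0)
  have an: "(\<lambda>z. poly P (z - \<zeta>) / poly Q (z - \<zeta>)) analytic_on {\<zeta>}"
    unfolding analytic_at using Q0
    by (intro exI[of _ "{z. poly Q (z - \<zeta>) \<noteq> 0}"] conjI open_Collect_neq continuous_intros holomorphic_intros) auto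
  have "fps_expansion (remove_sings (\<lambda>z. poly P (z - \<zeta>) / poly Q (z - \<zeta>))) \<zeta> =
      fps_expansion (\<lambda>z. poly P (z - \<zeta>) / poly Q (z - \<zeta>)) \<zeta>"
    by (rule fps_expansion_cong[OF eventually_remove_sings_eq_nhds[OF an]])
  also have "\<dots> = fps_expansion (\<lambda>w. poly P w / poly Q w) 0"
    unfolding fps_expansion_def by (subst higher_deriv_shift_0) (simp add: o_def)
  also have "\<dots> = fps_of_poly P / fps_of_poly Q"
    using assms by (intro fps_expansion_eqI has_fps_expansion_divide' has_fps_expansion_poly) simp
  finally show ?thesis .
qed

lemma eventually_poly_shift_nonzero:
  assumes "(Q :: complex poly) \<noteq> 0"
  shows "eventually (\<lambda>w. poly Q (w - \<zeta>) \<noteq> 0) (at z)"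
proof -
  have "finite ((\<lambda>w. w + \<zeta>) ` {w. poly Q w = 0})" using assms by (simp add: poly_roots_finite)
  then have "\<forall>\<^sub>F w in at z. w \<notin> (\<lambda>w. w + \<zeta>) ` {w. poly Q w = 0}"
    using islimpt_finite[of _ z] by (simp add: islimpt_iff_eventually)
  then show ?thesis
  proof eventually_elim
    case (elim w)
    have "w = (w - \<zeta>) + \<zeta>" by simp
    then show ?case using elim by blast
  qed
qed

text \<open>For two solutions P/Q and P'/Q' the polynomial P Q' - P' Q has degree at most p + q, and
  all its coefficients up to that index vanish.\<close>

lemma is_pade_unique:
  assumes "is_pade \<Omega> f p q \<zeta> R\<^sub>1" "is_pade \<Omega> f p q \<zeta> R\<^sub>2"
  shows "R\<^sub>1 = R\<^sub>2"
proof -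
  obtain P Q where 1: "degree P \<le> p" "degree Q \<le> q" "poly.coeff Q 0 = 1"
    "R\<^sub>1 = remove_sings (\<lambda>z. poly P (z - \<zeta>) / poly Q (z - \<zeta>))"
    "\<And>v. v \<le> p + q \<Longrightarrow> fps_nth (fps_expansion R\<^sub>1 \<zeta>) v = taylor_coeff \<Omega> f \<zeta> (int v)"
    using assms(1) unfolding is_pade_def by blast
  obtain P' Q' where 2: "degree P' \<le> p" "degree Q' \<le> q" "poly.coeff Q' 0 = 1"
    "R\<^sub>2 = remove_sings (\<lambda>z. poly P' (z - \<zeta>) / poly Q' (z - \<zeta>))"
    "\<And>v. v \<le> p + q \<Longrightarrow> fps_nth (fps_expansion R\<^sub>2 \<zeta>) v = taylor_coeff \<Omega> f \<zeta> (int v)"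
    using assms(2) unfolding is_pade_def by blast
  define H where "H = fps_of_poly P / fps_of_poly Q - fps_of_poly P' / fps_of_poly Q'"
  have H0: "fps_nth H v = 0" if "v \<le> p + q" for v
    using 1(5)[OF that] 2(5)[OF that] fps_expansion_rational[of Q P \<zeta>] fps_expansion_rational[of Q' P' \<zeta>]
    unfolding 1(4) 2(4) H_def by (simp add: 1(3) 2(3))
  have unit: "fps_nth (fps_of_poly Q) 0 \<noteq> 0" "fps_nth (fps_of_poly Q') 0 \<noteq> 0" using 1(3) 2(3) by simp_all
  have cancel: "F / fps_of_poly Q * fps_of_poly Q = F" "F / fps_of_poly Q' * fps_of_poly Q' = F" for F
    using unit by (simp_all add: fps_divide_unit mult.assoc inverse_mult_eq_1)
  have "H * (fps_of_poly Q * fps_of_poly Q') = fps_of_poly P / fps_of_poly Q * fps_of_poly Q * fps_of_poly Q'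
      - fps_of_poly P' / fps_of_poly Q' * fps_of_poly Q' * fps_of_poly Q"
    by (simp add: H_def algebra_simps)
  also have "\<dots> = fps_of_poly (P * Q' - P' * Q)"
    unfolding cancel by (simp add: fps_of_poly_diff fps_of_poly_mult)
  finally have eq: "H * (fps_of_poly Q * fps_of_poly Q') = fps_of_poly (P * Q' - P' * Q)" .
  have "P * Q' - P' * Q = 0"
  proof (rule poly_eqI)
    fix k
    show "poly.coeff (P * Q' - P' * Q) k = poly.coeff 0 k"
    proof (cases "k \<le> p + q")
      case True
      have "poly.coeff (P * Q' - P' * Q) k = fps_nth (H * (fps_of_poly Q * fps_of_poly Q')) k"
        unfolding eq by simp
      also have "\<dots> = 0" unfolding fps_mult_nth[of H] using H0 True by (intro sum.neutral) auto
      finally show ?thesis by simp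
    next
      case False
      have "degree (P * Q' - P' * Q) \<le> p + q"
        using degree_mult_le[of P Q'] degree_mult_le[of P' Q] 1(1,2) 2(1,2)
        by (intro degree_diff_le) auto
      then have "poly.coeff (P * Q' - P' * Q) k = 0" using False by (intro coeff_eq_0) simp
      then show ?thesis by simp
    qed
  qed
  then have cross: "poly P w * poly Q' w = poly P' w * poly Q w" for w
  proof -
    have "poly (P * Q') w = poly (P' * Q) w" using \<open>P * Q' - P' * Q = 0\<close> by simp
    then show ?thesis by (simp only: poly_mult)
  qed
  have nz: "Q \<noteq> 0" "Q' \<noteq> 0" using 1(3) 2(3) by auto
  \<comment> \<open>The fractions agree off the finitely many zeros of the two denominators, and
    \<open>remove_sings\<close> depends only on the values near, but not at, a point.\<close>
  show ?thesis
    unfolding 1(4) 2(4)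
  proof (intro ext remove_sings_cong refl)
    fix z
    show "\<forall>\<^sub>F w in at z. poly P (w - \<zeta>) / poly Q (w - \<zeta>) = poly P' (w - \<zeta>) / poly Q' (w - \<zeta>)"
      using eventually_poly_shift_nonzero[OF nz(1), of \<zeta> z] eventually_poly_shift_nonzero[OF nz(2), of \<zeta> z]
      by eventually_elim (simp add: frac_eq_eq cross)
  qed
qed

text \<open>The condition Q F = P up to order p + q is linear in P and Q, which makes it the form
  that the Hankel system delivers. Division by the unit Q gives the Taylor conditions, and
  uniqueness resolves the definite description.\<close>

lemma pade_eqI:
  assumes "degree P \<le> p" "degree Q \<le> q" "poly.coeff Q 0 = 1"
    and QF: "\<And>k. k \<le> p + q \<Longrightarrow>
      fps_nth (fps_of_poly Q * Abs_fps (\<lambda>v. taylor_coeff \<Omega> f \<zeta> (int v))) k = poly.coeff P k"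
  shows "pade \<Omega> f p q \<zeta> = remove_sings (\<lambda>z. poly P (z - \<zeta>) / poly Q (z - \<zeta>))" (is "_ = ?R")
proof -
  define F where "F = Abs_fps (\<lambda>v. taylor_coeff \<Omega> f \<zeta> (int v))"
  have unit: "fps_nth (fps_of_poly Q) 0 \<noteq> 0" using assms(3) by simp
  have "fps_of_poly Q * (fps_of_poly P / fps_of_poly Q - F) = fps_of_poly P - fps_of_poly Q * F"
  proof -
    have "fps_of_poly Q * (fps_of_poly P / fps_of_poly Q) = fps_of_poly P * (fps_of_poly Q * inverse (fps_of_poly Q))"
      by (simp only: fps_divide_unit[OF unit] mult_ac)
    then show ?thesis by (simp only: right_diff_distrib inverse_mult_eq_1'[OF unit] mult_1_right)
  qed
  then have "fps_nth (fps_of_poly Q * (fps_of_poly P / fps_of_poly Q - F)) k = 0" if "k \<le> p + q" for k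
    using QF[OF that] by (simp only: F_def fps_sub_nth fps_of_poly_nth) simp
  from fps_nth_mult_cancel[OF unit this]
  have "fps_nth (fps_of_poly P / fps_of_poly Q) v = taylor_coeff \<Omega> f \<zeta> (int v)" if "v \<le> p + q" for v
    using that by (simp add: F_def)
  then have "fps_nth (fps_expansion ?R \<zeta>) v = taylor_coeff \<Omega> f \<zeta> (int v)" if "v \<le> p + q" for v
    using that assms(3) by (simp add: fps_expansion_rational)
  then have "is_pade \<Omega> f p q \<zeta> ?R"
    unfolding is_pade_def using assms(1-3) by (intro conjI exI[of _ P] exI[of _ Q] allI impI) auto
  then show ?thesis
    unfolding pade_def by (intro the_equality is_pade_unique)
qed

section \<open>Functions holomorphic near the closure as elements of \<open>A_inf\<close>\<close>

lemma closure_deriv_restrict: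
  assumes "open \<Omega>" "open V" "closure \<Omega> \<subseteq> V" "h holomorphic_on V" "z \<in> closure \<Omega>"
  shows "closure_deriv \<Omega> l (restrict h \<Omega>) z = (deriv ^^ l) h z"
proof (rule closure_deriv_eq)
  have hol: "(deriv ^^ l) h holomorphic_on V" using assms by (intro holomorphic_higher_deriv)
  show "continuous_on (closure \<Omega>) ((deriv ^^ l) h)"
    by (rule holomorphic_on_imp_continuous_on[OF holomorphic_on_subset[OF hol assms(3)]])
  fix w assume w: "w \<in> \<Omega>"
  have hO: "h holomorphic_on \<Omega>" by (rule holomorphic_on_subset[OF assms(4) subset_trans[OF closure_subset assms(3)]])
  then have "restrict h \<Omega> holomorphic_on \<Omega>" by (rule holomorphic_transform) simp
  then show "(deriv ^^ l) h w = (deriv ^^ l) (restrict h \<Omega>) w"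
    using hO w assms(1) by (intro higher_deriv_transform_within_open[of _ \<Omega>]) auto
qed (use assms in auto)

lemma restrict_in_A_inf:
  assumes "open \<Omega>" "open V" "closure \<Omega> \<subseteq> V" "h holomorphic_on V"
  shows "restrict h \<Omega> \<in> A_inf \<Omega>"
proof -
  have hO: "h holomorphic_on \<Omega>" by (rule holomorphic_on_subset[OF assms(4) subset_trans[OF closure_subset assms(3)]])
  then have rO: "restrict h \<Omega> holomorphic_on \<Omega>" by (rule holomorphic_transform) simp
  have "\<exists>g. continuous_on (closure \<Omega>) g \<and> (\<forall>z\<in>\<Omega>. g z = (deriv ^^ l) (restrict h \<Omega>) z)" for l
  proof (intro exI conjI ballI)
    have hol: "(deriv ^^ l) h holomorphic_on V" using assms by (intro holomorphic_higher_deriv)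
    show "continuous_on (closure \<Omega>) ((deriv ^^ l) h)"
      by (rule holomorphic_on_imp_continuous_on[OF holomorphic_on_subset[OF hol assms(3)]])
    fix w assume w: "w \<in> \<Omega>"
    show "(deriv ^^ l) h w = (deriv ^^ l) (restrict h \<Omega>) w"
      using hO rO w assms(1) by (intro higher_deriv_transform_within_open[of _ \<Omega>]) auto
  qed
  then show ?thesis unfolding A_inf_def using rO by (intro CollectI conjI allI) simp_all
qed

text \<open>The expansions of \<open>g\<close> at all centres in \<open>K\<close> share the
  coefficient of index p, vanish beyond it and have a common bound, so one \<delta> of the
  perturbation lemma fits all of them. Order p + q covers the coefficients that enter [p/q], order N
  the final comparison of \<open>f\<close> with \<open>g\<close>.\<close>

lemma pade_near_polynomial:
  fixes g :: "complex poly"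
  assumes O: "open \<Omega>" and K: "compact K" "K \<subseteq> closure \<Omega>" and g: "g \<noteq> 0" "degree g = p" and \<epsilon>: "\<epsilon> > 0"
  shows "\<exists>\<delta>>0. \<forall>f\<in>A_inf_nbhd \<Omega> (restrict (poly g) \<Omega>) K (max N (p + q)) \<delta>. \<forall>\<zeta>\<in>K.
    f \<in> pade_class \<Omega> p q \<zeta> \<and> (\<forall>l\<le>N. \<forall>z\<in>K.
      rational_dist ((deriv ^^ l) (pade \<Omega> f p q \<zeta>)) z (closure_deriv \<Omega> l f z) \<le> ennreal \<epsilon>)"
proof -
  define c where "c = lead_coeff g"
  have c: "c \<noteq> 0" using g(1) by (simp add: c_def)
  have cd: "closure_deriv \<Omega> l (restrict (poly g) \<Omega>) z = (deriv ^^ l) (poly g) z" if "z \<in> K" for l z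
  proof (rule closure_deriv_restrict[OF O open_UNIV])
    show "poly g holomorphic_on UNIV" by (intro holomorphic_intros)
  qed (use K that in auto)
  define \<alpha> where "\<alpha> \<zeta> i = taylor_coeff \<Omega> (restrict (poly g) \<Omega>) \<zeta> i" for \<zeta> i
  have \<alpha>: "\<alpha> \<zeta> (int k) = poly.coeff (g \<circ>\<^sub>p [:\<zeta>, 1:]) k" if "\<zeta> \<in> K" for \<zeta> k
  proof -
    have "poly.coeff (g \<circ>\<^sub>p [:\<zeta>, 1:]) k = (deriv ^^ k) (poly (g \<circ>\<^sub>p [:\<zeta>, 1:])) 0 / fact k"
      using fps_nth_fps_expansion[OF has_fps_expansion_poly, of "g \<circ>\<^sub>p [:\<zeta>, 1:]" k] by simp
    also have "poly (g \<circ>\<^sub>p [:\<zeta>, 1:]) = poly g \<circ> (+) \<zeta>" by (auto simp: poly_pcompose)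
    also have "(deriv ^^ k) \<dots> 0 = (deriv ^^ k) (poly g) \<zeta>" by (rule higher_deriv_shift_0[symmetric])
    finally show ?thesis using that by (simp add: \<alpha>_def taylor_coeff_def cd)
  qed
  have deg: "degree (g \<circ>\<^sub>p [:\<zeta>, 1:]) = p" for \<zeta> using g by (simp add: degree_pcompose)
  have \<alpha>p: "\<alpha> \<zeta> (int p) = c" if "\<zeta> \<in> K" for \<zeta>
    using lead_coeff_comp[of "[:\<zeta>, 1:]" g] that by (simp add: \<alpha> deg c_def)
  have \<alpha>hi: "\<alpha> \<zeta> i = 0" if "\<zeta> \<in> K" "int p < i" for \<zeta> i
    using \<alpha>[OF that(1), of "nat i"] that(2) deg[of \<zeta>] by (simp add: coeff_eq_0)
  obtain B where B: "B \<ge> 0" "\<And>\<zeta> i. \<zeta> \<in> K \<Longrightarrow> cmod (\<alpha> \<zeta> i) \<le> B"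
  proof -
    have "\<exists>b\<ge>0. \<forall>\<zeta>\<in>K. cmod (\<alpha> \<zeta> (int k)) \<le> b" for k
    proof -
      have "continuous_on K (\<lambda>\<zeta>. poly ((pderiv ^^ k) g) \<zeta> / fact k)" by (intro continuous_intros) auto
      then have "bounded ((\<lambda>\<zeta>. poly ((pderiv ^^ k) g) \<zeta> / fact k) ` K)"
        using K(1) compact_continuous_image compact_imp_bounded by blast
      then obtain m where m: "m > 0" "\<forall>y\<in>(\<lambda>\<zeta>. poly ((pderiv ^^ k) g) \<zeta> / fact k) ` K. cmod y \<le> m"
        unfolding bounded_pos by blast
      have "cmod (\<alpha> \<zeta> (int k)) \<le> m" if "\<zeta> \<in> K" for \<zeta>
        using m(2) that by (simp add: \<alpha>_def taylor_coeff_def cd higher_deriv_poly)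
      then show ?thesis using m(1) less_imp_le by blast
    qed
    then have "\<forall>k. \<exists>b\<ge>0. \<forall>\<zeta>\<in>K. cmod (\<alpha> \<zeta> (int k)) \<le> b" by blast
    from choice[OF this] obtain b where b: "\<And>k. b k \<ge> 0" "\<And>k \<zeta>. \<zeta> \<in> K \<Longrightarrow> cmod (\<alpha> \<zeta> (int k)) \<le> b k"
      by blast
    have b0: "(\<Sum>k\<le>p. b k) \<ge> 0" using b(1) by (intro sum_nonneg)
    have "cmod (\<alpha> \<zeta> i) \<le> (\<Sum>k\<le>p. b k)" if z: "\<zeta> \<in> K" for \<zeta> i
    proof (cases "0 \<le> i \<and> i \<le> int p")
      case True
      then have "cmod (\<alpha> \<zeta> i) \<le> b (nat i)" using b(2)[OF z, of "nat i"] by simp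
      also have "\<dots> \<le> (\<Sum>k\<le>p. b k)" using True b(1) by (intro member_le_sum) auto
      finally show ?thesis .
    next
      case False
      then have "\<alpha> \<zeta> i = 0" using \<alpha>hi[OF z, of i] by (auto simp: \<alpha>_def taylor_coeff_def)
      then show ?thesis using b0 by simp
    qed
    then show ?thesis using that b0 by blast
  qed
  obtain R\<^sub>0 where R0: "R\<^sub>0 > 0" "\<And>z. z \<in> K \<Longrightarrow> cmod z \<le> R\<^sub>0"
    using compact_imp_bounded[OF K(1)] by (auto simp: bounded_pos)
  \<comment> \<open>The fraction is studied on discs of radius 1 about points of \<open>K\<close>:
    there |w - \<zeta>| is at most 1 + |z| + |\<zeta>|.\<close>
  define M where "M = 2 * R\<^sub>0 + 1"
  have M: "M \<ge> 0" using R0 by (simp add: M_def)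
  obtain \<eta> where \<eta>: "\<eta> > 0" "\<forall>f z l. f holomorphic_on ball z 1 \<and> continuous_on (cball z 1) f \<and>
    (\<forall>w\<in>cball z 1. cmod (f w) \<le> \<eta>) \<and> l \<le> N \<longrightarrow> cmod ((deriv ^^ l) f z) < \<epsilon> / 2"
    using higher_deriv_small[of 1 "\<epsilon> / 2" N] \<epsilon> by auto
  obtain \<delta> where \<delta>: "\<delta> > 0" "\<forall>\<alpha> \<beta> :: int \<Rightarrow> complex.
    (\<forall>i<0. \<beta> i = 0) \<and> (\<forall>i. 0 \<le> i \<and> i \<le> int p + int q \<longrightarrow> cmod (\<beta> i - \<alpha> i) \<le> \<delta>) \<and>
    \<alpha> (int p) = c \<and> (\<forall>i>int p. \<alpha> i = 0) \<and> (\<forall>i. cmod (\<alpha> i) \<le> B) \<longrightarrow>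
    Determinant.det (Matrix.mat q q (\<lambda>(i, j). \<beta> (int p - int q + int i + int j + 1))) \<noteq> 0 \<and>
    (\<exists>P Q. degree P \<le> p \<and> degree Q \<le> q \<and> poly.coeff Q 0 = 1 \<and>
      (\<forall>k\<le>p+q. fps_nth (fps_of_poly Q * Abs_fps (\<lambda>v. \<beta> (int v))) k = poly.coeff P k) \<and>
      (\<forall>w. cmod w \<le> M \<longrightarrow> poly Q w \<noteq> 0 \<and>
         cmod (poly P w / poly Q w - (\<Sum>k\<le>p. \<alpha> (int k) * w ^ k)) \<le> \<eta>))"
    using pade_of_perturbed_polynomial[OF c B(1) M \<eta>(1), of p q] by blast
  show ?thesis
  proof (intro exI[of _ "min \<delta> (\<epsilon> / 2)"] conjI ballI)
    show "min \<delta> (\<epsilon> / 2) > 0" using \<delta>(1) \<epsilon> by simp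
    fix f \<zeta>
    assume f: "f \<in> A_inf_nbhd \<Omega> (restrict (poly g) \<Omega>) K (max N (p + q)) (min \<delta> (\<epsilon> / 2))" and \<zeta>: "\<zeta> \<in> K"
    define \<beta> where "\<beta> = taylor_coeff \<Omega> f \<zeta>"
    have fg: "cmod (closure_deriv \<Omega> i f z - closure_deriv \<Omega> i (restrict (poly g) \<Omega>) z) < min \<delta> (\<epsilon> / 2)"
      if "i \<le> max N (p + q)" "z \<in> K" for i z
      using f that by (auto simp: A_inf_nbhd_def)
    have close: "cmod (\<beta> i - \<alpha> \<zeta> i) \<le> \<delta>" if "0 \<le> i" "i \<le> int p + int q" for i
    proof -
      let ?d = "closure_deriv \<Omega> (nat i) f \<zeta> - closure_deriv \<Omega> (nat i) (restrict (poly g) \<Omega>) \<zeta>"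
      have "\<beta> i - \<alpha> \<zeta> i = ?d / fact (nat i)"
        using that by (simp add: \<beta>_def \<alpha>_def taylor_coeff_def diff_divide_distrib)
      then have "cmod (\<beta> i - \<alpha> \<zeta> i) = cmod ?d / fact (nat i)" by (simp add: norm_divide)
      also have "\<dots> \<le> cmod ?d / 1" by (intro divide_left_mono) (auto simp: fact_ge_1)
      also have "\<dots> \<le> \<delta>"
      proof -
        have "nat i \<le> max N (p + q)" using that by linarith
        from fg[OF this \<zeta>] show ?thesis by simp
      qed
      finally show ?thesis .
    qed
    have "\<beta> i = 0" if "i < 0" for i using that by (simp add: \<beta>_def taylor_coeff_def)
    then have "(\<forall>i<0. \<beta> i = 0) \<and> (\<forall>i. 0 \<le> i \<and> i \<le> int p + int q \<longrightarrow> cmod (\<beta> i - \<alpha> \<zeta> i) \<le> \<delta>) \<and>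
        \<alpha> \<zeta> (int p) = c \<and> (\<forall>i>int p. \<alpha> \<zeta> i = 0) \<and> (\<forall>i. cmod (\<alpha> \<zeta> i) \<le> B)"
      by (simp add: close \<alpha>p[OF \<zeta>] \<alpha>hi[OF \<zeta>] B(2)[OF \<zeta>])
    from \<delta>(2)[rule_format, OF this]
    obtain P Q where det: "Determinant.det (Matrix.mat q q (\<lambda>(i, j). \<beta> (int p - int q + int i + int j + 1))) \<noteq> 0"
      and PQ: "degree P \<le> p" "degree Q \<le> q" "poly.coeff Q 0 = 1"
        "\<And>k. k \<le> p + q \<Longrightarrow> fps_nth (fps_of_poly Q * Abs_fps (\<lambda>v. \<beta> (int v))) k = poly.coeff P k"
      and near: "\<And>w. cmod w \<le> M \<Longrightarrow> poly Q w \<noteq> 0 \<and>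
         cmod (poly P w / poly Q w - (\<Sum>k\<le>p. \<alpha> \<zeta> (int k) * w ^ k)) \<le> \<eta>"
      by blast
    have "f \<in> A_inf \<Omega>" using f by (simp add: A_inf_nbhd_def)
    then show "f \<in> pade_class \<Omega> p q \<zeta>" using det by (simp add: pade_class_def \<beta>_def)
    show "\<forall>l\<le>N. \<forall>z\<in>K. rational_dist ((deriv ^^ l) (pade \<Omega> f p q \<zeta>)) z (closure_deriv \<Omega> l f z) \<le> ennreal \<epsilon>"
    proof (intro allI impI ballI)
      fix l z assume l: "l \<le> N" and z: "z \<in> K"
      define r where "r w = poly P (w - \<zeta>) / poly Q (w - \<zeta>)" for w
      define D where "D = {w. poly Q (w - \<zeta>) \<noteq> 0}"
      have pade: "pade \<Omega> f p q \<zeta> = remove_sings r"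
        unfolding r_def using PQ by (intro pade_eqI) (auto simp: \<beta>_def)
      have opD: "open D" unfolding D_def by (intro open_Collect_neq continuous_intros)
      have holr: "r holomorphic_on D" unfolding r_def D_def by (intro holomorphic_intros) auto
      have small: "cmod (w - \<zeta>) \<le> M" if "w \<in> cball z 1" for w
      proof -
        have "cmod (w - \<zeta>) \<le> cmod (w - z) + cmod z + cmod \<zeta>"
          using norm_triangle_ineq[of "w - z" z] norm_triangle_ineq4[of w \<zeta>] by simp
        then show ?thesis using R0(2)[OF z] R0(2)[OF \<zeta>] that by (simp add: M_def dist_norm norm_minus_commute)
      qed
      have cD: "cball z 1 \<subseteq> D" using near small by (auto simp: D_def)
      then have zD: "z \<in> D" by auto
      have rs: "remove_sings r w = r w" if "w \<in> D" for w
        using that holr opD by (intro remove_sings_at_analytic) (auto simp: analytic_at)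
      have holR: "remove_sings r holomorphic_on D" by (rule holomorphic_transform[OF holr]) (simp add: rs)
      have dR: "(deriv ^^ l) (remove_sings r) z = (deriv ^^ l) r z"
        using rs by (intro higher_deriv_transform_within_open[OF holR holr opD zD])
      \<comment> \<open>At a pole \<open>rational_dist\<close> would be infinite; holomorphy on
        \<open>D\<close>, where the denominator has no zeros, rules this out.\<close>
      have np: "\<not> is_pole ((deriv ^^ l) (remove_sings r)) z"
        by (rule not_is_pole_holomorphic[OF opD zD holomorphic_higher_deriv[OF holR opD]])
      have expand: "poly g w = (\<Sum>k\<le>p. \<alpha> \<zeta> (int k) * (w - \<zeta>) ^ k)" for w
      proof -
        have "poly g w = poly (g \<circ>\<^sub>p [:\<zeta>, 1:]) (w - \<zeta>)" by (simp add: poly_pcompose)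
        also have "\<dots> = (\<Sum>k\<le>p. \<alpha> \<zeta> (int k) * (w - \<zeta>) ^ k)" by (simp add: poly_altdef deg \<alpha>[OF \<zeta>])
        finally show ?thesis .
      qed
      have hold: "(\<lambda>w. r w - poly g w) holomorphic_on D" using holr by (intro holomorphic_intros)
      \<comment> \<open>One half of \<epsilon> is spent here, between the fraction and
        \<open>g\<close> on a disc that may leave the closure of \<Omega>; the other half separates
        \<open>g\<close> from \<open>f\<close> at z itself.\<close>
      have "cmod ((deriv ^^ l) (\<lambda>w. r w - poly g w) z) < \<epsilon> / 2"
      proof (intro \<eta>(2)[rule_format] conjI l)
        show "(\<lambda>w. r w - poly g w) holomorphic_on ball z 1"
          using cD ball_subset_cball by (intro holomorphic_on_subset[OF hold]) blast
        show "continuous_on (cball z 1) (\<lambda>w. r w - poly g w)"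
          by (rule holomorphic_on_imp_continuous_on[OF holomorphic_on_subset[OF hold cD]])
        show "\<forall>w\<in>cball z 1. cmod (r w - poly g w) \<le> \<eta>"
          unfolding r_def expand using near small by blast
      qed
      then have "cmod ((deriv ^^ l) r z - (deriv ^^ l) (poly g) z) < \<epsilon> / 2"
        using higher_deriv_diff[OF holr _ opD zD, of "poly g" l] by (simp add: holomorphic_intros)
      moreover have "cmod ((deriv ^^ l) (poly g) z - closure_deriv \<Omega> l f z) < \<epsilon> / 2"
        using fg[of l z] l z by (simp add: cd norm_minus_commute)
      ultimately have "cmod ((deriv ^^ l) r z - closure_deriv \<Omega> l f z) < \<epsilon>"
        using norm_triangle_ineq[of "(deriv ^^ l) r z - (deriv ^^ l) (poly g) z"
            "(deriv ^^ l) (poly g) z - closure_deriv \<Omega> l f z"] by simp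
      then show "rational_dist ((deriv ^^ l) (pade \<Omega> f p q \<zeta>)) z (closure_deriv \<Omega> l f z) \<le> ennreal \<epsilon>"
        using np dR by (simp add: rational_dist_def pade ennreal_leI)
    qed
  qed
qed

section \<open>Generic approximation\<close>

lemma higher_deriv_smult_small:
  fixes r :: "complex poly"
  assumes "compact K" "\<epsilon> > 0"
  shows "\<exists>\<eta>>0. \<forall>l\<le>N. \<forall>z\<in>K. cmod ((deriv ^^ l) (poly (Polynomial.smult (of_real \<eta>) r)) z) < \<epsilon>"
proof -
  have "bounded (\<Union>l\<le>N. poly ((pderiv ^^ l) r) ` K)"
    using assms(1) by (intro bounded_UN ballI compact_imp_bounded compact_continuous_image continuous_intros) auto
  then obtain M where M: "M > 0" "\<forall>y\<in>(\<Union>l\<le>N. poly ((pderiv ^^ l) r) ` K). cmod y \<le> M"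
    unfolding bounded_pos by blast
  show ?thesis
  proof (intro exI[of _ "\<epsilon> / (2 * M)"] conjI allI impI ballI)
    show "\<epsilon> / (2 * M) > 0" using assms M by simp
    fix l z assume "l \<le> N" "z \<in> K"
    then have "cmod (poly ((pderiv ^^ l) r) z) \<le> M" using M(2) by blast
    then have "\<epsilon> / (2 * M) * cmod (poly ((pderiv ^^ l) r) z) \<le> \<epsilon> / (2 * M) * M"
      using assms M by (intro mult_left_mono) auto
    also have "\<dots> < \<epsilon>" using assms M by simp
    finally show "cmod ((deriv ^^ l) (poly (Polynomial.smult (of_real (\<epsilon> / (2 * M))) r)) z) < \<epsilon>"
      using assms M by (simp add: higher_deriv_poly higher_pderiv_smult norm_mult norm_divide)
  qed
qed

text \<open>One approximating polynomial is fixed first, and every p above its degree is then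
  attained. This order lets p be picked from \<open>\<F>\<close> afterwards.\<close>

lemma polynomials_of_exact_degree_near_H_closure:
  assumes O: "open \<Omega>" and conn: "connectedin riemann_sphere (topspace riemann_sphere - Some ` closure \<Omega>)"
    and h: "h \<in> H_closure \<Omega>" and W: "openin (A_inf_topology \<Omega>) W" "h \<in> W"
  shows "\<exists>d :: nat. \<forall>p>d. \<exists>g. g \<noteq> 0 \<and> degree g = p \<and> restrict (poly g) \<Omega> \<in> W"
proof -
  obtain h' V where h': "h = restrict h' \<Omega>" "open V" "closure \<Omega> \<subseteq> V" "h' holomorphic_on V"
    using h unfolding H_closure_def by blast
  obtain K N \<epsilon> where K: "compact K" "K \<subseteq> closure \<Omega>" "\<epsilon> > 0" "A_inf_nbhd \<Omega> h K N \<epsilon> \<subseteq> W"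
    using W unfolding openin_A_inf_topology by blast
  have "- outside K \<subseteq> V" using connected_complement_imp_outside[OF conn K(1,2)] h'(3) by blast
  then obtain p\<^sub>0 where p0: "\<forall>l\<le>N. \<forall>z\<in>K.
      cmod ((deriv ^^ l) h' z - (deriv ^^ l) (poly p\<^sub>0) z) < \<epsilon> / 2"
    using polynomial_higher_deriv_approx[OF K(1) h'(2) _ h'(4) half_gt_zero[OF K(3)], of N] by blast
  show ?thesis
  proof (intro exI[of _ "degree p\<^sub>0"] allI impI)
    fix p assume p: "p > degree p\<^sub>0"
    obtain \<eta> where \<eta>: "\<eta> > 0" "\<forall>l\<le>N. \<forall>z\<in>K.
        cmod ((deriv ^^ l) (poly (Polynomial.smult (of_real \<eta>) (Polynomial.monom 1 p))) z) < \<epsilon> / 2"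
      using higher_deriv_smult_small[OF K(1) half_gt_zero[OF K(3)]] by blast
    define r where "r = Polynomial.smult (of_real \<eta>) (Polynomial.monom (1 :: complex) p)"
    define g where "g = p\<^sub>0 + r"
    have dr: "degree r = p" using \<eta>(1) by (simp add: r_def degree_monom_eq)
    have dg: "degree g = p" unfolding g_def using p dr by (simp add: degree_add_eq_right)
    have hol: "poly g holomorphic_on UNIV" by (intro holomorphic_intros)
    have "restrict (poly g) \<Omega> \<in> A_inf_nbhd \<Omega> h K N \<epsilon>"
      unfolding A_inf_nbhd_def
    proof (intro CollectI conjI allI impI ballI)
      show "restrict (poly g) \<Omega> \<in> A_inf \<Omega>" by (rule restrict_in_A_inf[OF O open_UNIV _ hol]) simp
      fix l z assume l: "l \<le> N" and z: "z \<in> K"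
      have "closure_deriv \<Omega> l (restrict (poly g) \<Omega>) z = (deriv ^^ l) (poly g) z"
        by (rule closure_deriv_restrict[OF O open_UNIV _ hol]) (use z K(2) in auto)
      also have "\<dots> = (deriv ^^ l) (poly p\<^sub>0) z + (deriv ^^ l) (poly r) z"
        by (simp add: g_def higher_deriv_poly higher_pderiv_add)
      finally have "closure_deriv \<Omega> l (restrict (poly g) \<Omega>) z - closure_deriv \<Omega> l h z =
          (deriv ^^ l) (poly r) z - ((deriv ^^ l) h' z - (deriv ^^ l) (poly p\<^sub>0) z)"
        using closure_deriv_restrict[OF O h'(2-4), of z l] z K(2) by (auto simp: h'(1))
      then show "cmod (closure_deriv \<Omega> l (restrict (poly g) \<Omega>) z - closure_deriv \<Omega> l h z) < \<epsilon>"
        using \<eta>(2)[rule_format, OF l z] p0[rule_format, OF l z]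
          norm_triangle_ineq4[of "(deriv ^^ l) (poly r) z" "(deriv ^^ l) h' z - (deriv ^^ l) (poly p\<^sub>0) z"]
        by (simp add: r_def)
    qed
    moreover have "g \<noteq> 0" using dg p by auto
    ultimately show "\<exists>g. g \<noteq> 0 \<and> degree g = p \<and> restrict (poly g) \<Omega> \<in> W" using dg K(4) by blast
  qed
qed

theorem theorem4p7:
  fixes \<Omega> :: "complex set" and \<F> :: "(nat \<times> nat) set"
  assumes "open \<Omega>"
    and "connectedin riemann_sphere (topspace riemann_sphere - Some ` closure \<Omega>)"
    and "\<exists>pt qt :: nat \<Rightarrow> nat. (\<forall>n\<ge>1. (pt n, qt n) \<in> \<F>) \<and> filterlim pt at_top sequentially"
  shows "generically (X_inf \<Omega>) (\<lambda>f.
    \<exists>p q :: nat \<Rightarrow> nat. (\<forall>n. (p n, q n) \<in> \<F>) \<and>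
      (\<forall>K. compact K \<and> K \<subseteq> closure \<Omega> \<longrightarrow>
        (\<exists>nK. \<forall>n\<ge>nK. \<forall>\<zeta>\<in>K. f \<in> pade_class \<Omega> (p n) (q n) \<zeta>) \<and>
        (\<forall>l. (\<lambda>n. SUP \<zeta>\<in>K. SUP z\<in>K.
              rational_dist ((deriv ^^ l) (pade \<Omega> f (p n) (q n) \<zeta>)) z (closure_deriv \<Omega> l f z))
            \<longlonglongrightarrow> 0)))"
proof -
  define S where "S = A_inf_topology \<Omega> closure_of H_closure \<Omega>"
  have X: "X_inf \<Omega> = subtopology (A_inf_topology \<Omega>) S" by (simp add: X_inf_def S_def)
  have clS: "closedin (A_inf_topology \<Omega>) S" by (simp add: S_def)
  have SA: "S \<subseteq> A_inf \<Omega>" using closedin_subset[OF clS] by simp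
  have topX: "topspace (X_inf \<Omega>) = S" using SA by (auto simp: X)
  define L where "L m = closure \<Omega> \<inter> cball 0 (real m)" for m
  have L: "compact (L m)" "L m \<subseteq> closure \<Omega>" for m by (auto simp: L_def closed_Int_compact)
  define good where "good f m p q \<longleftrightarrow> (\<forall>\<zeta>\<in>L m. f \<in> pade_class \<Omega> p q \<zeta> \<and> (\<forall>l\<le>m. \<forall>z\<in>L m.
      rational_dist ((deriv ^^ l) (pade \<Omega> f p q \<zeta>)) z (closure_deriv \<Omega> l f z) \<le> ennreal (1 / Suc m)))"
    for f m p q
  \<comment> \<open>Taking the interior makes openness automatic, so density is all that has to be
    proved.\<close>
  define U where "U m = X_inf \<Omega> interior_of {f. \<exists>(p, q)\<in>\<F>. good f m p q}" for m
  have dense: "X_inf \<Omega> closure_of U m = topspace (X_inf \<Omega>)" for m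
  proof
    show "topspace (X_inf \<Omega>) \<subseteq> X_inf \<Omega> closure_of U m"
    proof
      fix f assume f: "f \<in> topspace (X_inf \<Omega>)"
      show "f \<in> X_inf \<Omega> closure_of U m"
        unfolding in_closure_of
      proof (intro conjI f allI impI)
        fix T assume "f \<in> T \<and> openin (X_inf \<Omega>) T"
        then obtain W where W: "openin (A_inf_topology \<Omega>) W" "T = W \<inter> S" "f \<in> W"
          by (auto simp: X openin_subtopology)
        have "f \<in> A_inf_topology \<Omega> closure_of H_closure \<Omega>" using f topX by (simp add: S_def)
        then obtain h where h: "h \<in> H_closure \<Omega>" "h \<in> W" using W(1,3) unfolding in_closure_of by blast
        obtain d where d: "\<forall>p>d. \<exists>g. g \<noteq> 0 \<and> degree g = p \<and> restrict (poly g) \<Omega> \<in> W"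
          using polynomials_of_exact_degree_near_H_closure[OF assms(1,2) h(1) W(1) h(2)] by blast
        obtain pt qt where pq: "\<forall>n\<ge>1. (pt n, qt n) \<in> \<F>" "filterlim pt at_top sequentially"
          using assms(3) by blast
        \<comment> \<open>Membership in \<open>\<F>\<close> is assumed from index 1 on, hence the
          extra condition on n.\<close>
        have "\<forall>\<^sub>F n in sequentially. n \<ge> 1 \<and> pt n > d"
          using pq(2)[unfolded filterlim_at_top, rule_format, of "Suc d"]
          by (intro eventually_conj eventually_ge_at_top) (simp add: Suc_le_eq)
        then obtain n where n: "n \<ge> 1" "pt n > d" by (auto simp: eventually_sequentially)
        define p q where "p = pt n" and "q = qt n"
        have F: "(p, q) \<in> \<F>" using pq(1) n(1) by (simp add: p_def q_def)
        obtain g where g: "g \<noteq> 0" "degree g = p" "restrict (poly g) \<Omega> \<in> W"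
          using d n(2) p_def by blast
        let ?g = "restrict (poly g) \<Omega>"
        have gA: "?g \<in> A_inf \<Omega>" using W(1) g(3) openin_subset by fastforce
        have "poly g holomorphic_on UNIV" by (intro holomorphic_intros)
        \<comment> \<open>The polynomial belongs to the subspace \<open>S\<close> because it is
          entire; this is what makes it a witness for density inside \<open>X_inf\<close>.\<close>
        then have "?g \<in> H_closure \<Omega>" unfolding H_closure_def by blast
        then have gS: "?g \<in> S"
          using gA closure_of_subset_Int[of "A_inf_topology \<Omega>" "H_closure \<Omega>"] by (auto simp: S_def)
        obtain \<delta> where \<delta>: "\<delta> > 0" "\<forall>f\<in>A_inf_nbhd \<Omega> ?g (L m) (max m (p + q)) \<delta>. \<forall>\<zeta>\<in>L m.
          f \<in> pade_class \<Omega> p q \<zeta> \<and> (\<forall>l\<le>m. \<forall>z\<in>L m.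
          rational_dist ((deriv ^^ l) (pade \<Omega> f p q \<zeta>)) z (closure_deriv \<Omega> l f z) \<le> ennreal (1 / Suc m))"
          using pade_near_polynomial[OF assms(1) L g(1,2), of "1 / Suc m" m m q] by auto
        obtain Y where Y: "openin (A_inf_topology \<Omega>) Y" "?g \<in> Y" "Y \<subseteq> A_inf_nbhd \<Omega> ?g (L m) (max m (p + q)) \<delta>"
          using openin_A_inf_nbhd_interior[OF assms(1) L \<delta>(1) gA] by blast
        have "Y \<inter> S \<subseteq> U m"
          unfolding U_def
        proof (rule interior_of_maximal)
          show "openin (X_inf \<Omega>) (Y \<inter> S)" unfolding X by (rule openin_subtopology_Int[OF Y(1)])
          have "good f m p q" if "f \<in> Y" for f
            unfolding good_def using \<delta>(2) Y(3) that by blast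
          then show "Y \<inter> S \<subseteq> {f. \<exists>(p, q)\<in>\<F>. good f m p q}" using F by blast
        qed
        then have "?g \<in> U m" using Y(2) gS by blast
        then show "\<exists>y. y \<in> U m \<and> y \<in> T" using W(2) g(3) gS by blast
      qed
    qed
  qed (rule closure_of_subset_topspace)
  have openU: "openin (X_inf \<Omega>) (U m)" for m unfolding U_def by (rule openin_interior_of)
  show ?thesis
    unfolding generically_def
  proof (intro exI[of _ "\<Inter>m. U m"] conjI ballI)
    show "gdelta_in (X_inf \<Omega>) (\<Inter>m. U m)"
      by (rule gdelta_in_Inter) (auto intro: open_imp_gdelta_in openU)
    show "X_inf \<Omega> closure_of (\<Inter>m. U m) = topspace (X_inf \<Omega>)"
      using A_inf_Baire[OF assms(1) clS, of U] openU dense unfolding X by blast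
    fix f assume "f \<in> (\<Inter>m. U m)"
    then have "\<forall>m. \<exists>pq. pq \<in> \<F> \<and> good f m (fst pq) (snd pq)"
      using interior_of_subset unfolding U_def by fastforce
    \<comment> \<open>The pair chosen for stage m becomes the m-th term of the sequence, so the
      sequence depends on \<open>f\<close> but not on the compact set.\<close>
    from choice[OF this] obtain s where s: "\<And>m. s m \<in> \<F>" "\<And>m. good f m (fst (s m)) (snd (s m))" by blast
    show "\<exists>p q :: nat \<Rightarrow> nat. (\<forall>n. (p n, q n) \<in> \<F>) \<and>
      (\<forall>K. compact K \<and> K \<subseteq> closure \<Omega> \<longrightarrow>
        (\<exists>nK. \<forall>n\<ge>nK. \<forall>\<zeta>\<in>K. f \<in> pade_class \<Omega> (p n) (q n) \<zeta>) \<and>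
        (\<forall>l. (\<lambda>n. SUP \<zeta>\<in>K. SUP z\<in>K.
              rational_dist ((deriv ^^ l) (pade \<Omega> f (p n) (q n) \<zeta>)) z (closure_deriv \<Omega> l f z))
            \<longlonglongrightarrow> 0))"
    proof (rule exI[of _ "\<lambda>n. fst (s n)"], rule exI[of _ "\<lambda>n. snd (s n)"],
        intro conjI allI impI; (elim conjE)?)
      show "(fst (s n), snd (s n)) \<in> \<F>" for n using s(1) by simp
      fix K assume K: "compact K" "K \<subseteq> closure \<Omega>"
      obtain k where k: "\<And>n. n \<ge> k \<Longrightarrow> K \<subseteq> L n"
        using compact_subset_closure_cball[OF K] unfolding L_def by blast
      show "\<exists>nK. \<forall>n\<ge>nK. \<forall>\<zeta>\<in>K. f \<in> pade_class \<Omega> (fst (s n)) (snd (s n)) \<zeta>"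
        using s(2) k unfolding good_def by blast
      fix l
      let ?E = "\<lambda>n. SUP \<zeta>\<in>K. SUP z\<in>K.
        rational_dist ((deriv ^^ l) (pade \<Omega> f (fst (s n)) (snd (s n)) \<zeta>)) z (closure_deriv \<Omega> l f z)"
      \<comment> \<open>From n \<ge> k on, \<open>K\<close> lies in \<open>L n\<close>, and from n
        \<ge> l on, the order l is among those controlled at stage n.\<close>
      have "?E n \<le> ennreal (1 / Suc n)" if n: "n \<ge> max k l" for n
      proof (intro SUP_least)
        fix \<zeta> z assume "\<zeta> \<in> K" "z \<in> K"
        then have "\<zeta> \<in> L n" "z \<in> L n" using k[of n] n by auto
        then show "rational_dist ((deriv ^^ l) (pade \<Omega> f (fst (s n)) (snd (s n)) \<zeta>)) z (closure_deriv \<Omega> l f z)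
            \<le> ennreal (1 / Suc n)"
          using s(2)[of n] n unfolding good_def by auto
      qed
      then have le: "\<forall>\<^sub>F n in sequentially. ?E n \<le> ennreal (1 / Suc n)"
        by (rule eventually_sequentiallyI)
      have ge: "\<forall>\<^sub>F n in sequentially. 0 \<le> ?E n" by (intro always_eventually allI zero_le)
      have "(\<lambda>n. ennreal (inverse (real (Suc n)))) \<longlonglongrightarrow> ennreal 0"
        by (rule tendsto_ennrealI[OF LIMSEQ_inverse_real_of_nat])
      then have lim: "(\<lambda>n. ennreal (1 / Suc n)) \<longlonglongrightarrow> 0"
        by (simp only: inverse_eq_divide ennreal_0)
      show "?E \<longlonglongrightarrow> 0" by (rule tendsto_sandwich[OF ge le tendsto_const lim])
    qed
  qed
qed

end
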